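(* Fix $n\ge 1$. Let $T(k,a,b,c)$ be the set of permutation tableaux contained in a $k\times(n-k)$ rectangle (with $k$ rows and $n-k$ columns) having exactly $a$ $0$'s, $b$ $1$'s and $c$ $2$'s. Let $M(k,a,b,c)$ be the set of all permutations $\pi\in\mathcal{S}_n$ with - $k=\mathrm{wex}(\pi)$, - $a=A_{EE}(\pi)+A_{NN}(\pi)+A_{EN}(\pi)$, - $b=C_{EE}(\pi)+C_{NN}(\pi)+(n-k)$, - $c=A_{NE}(\pi)$. Then $|T(k,a,b,c)|=|M(k,a,b,c)|$. Moreover, the map $\Phi$ is a bijection from $T(k,a,b,c)$ to $M(k,a,b,c)$ such that the weak excedance bottoms of $\pi=\Phi(\mathcal{T})$ are precisely the labels on the vertical edges of the partition path $P$ associated with $\mathcal{T}$.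
   Context: **Permutation tableaux.** A permutation tableau contained in a $k\times(n-k)$ rectangle is a partition $\lambda=(\lambda_1\ge\dots\ge\lambda_k\ge 0)$ with $\lambda_1\le n-k$, whose Young diagram $Y_\lambda$ (left-justified, $\lambda_i$ boxes in the $i$-th row from the top) is placed in the rectangle with its top row at the top and its left edge at the left side of the rectangle, together with a filling of the boxes of $Y_\lambda$ by $0$'s and $1$'s such that: (1) each of the $n-k$ columns of the rectangle contains at least one $1$; (2) there is no $0$ which has a $1$ above it in the same column and a $1$ to its left in the same row. Rows of length $0$ are allowed. Every box of the rectangle outside $Y_\lambda$ is filled with a $2$. **Partition path.** The southeast border of $Y_\lambda$ gives a lattice path $P$ of $n$ unit steps from the northeast corner to the southwest corner of the rectangle; its steps are labeled $1,\dots,n$ in the order taken. Vertical steps correspond to rows (right end of the row), horizontal steps to columns (bottom of the column). **Diagram.** Remove the $0$'s and $2$'s and replace each $1$ by a vertex. From each vertex draw an edge east to the next vertex in its row, or, if there is none, to the label of the vertical step at the right end of the row; and an edge south to the next vertex in its column, or, if there is none, to the label of the horizontal step at the bottom of the column. **The map $\Phi$.** Given a permutation tableau $\mathcal{T}$, define $\pi=\Phi(\mathcal{T})$ as follows. If $i$ labels a vertical step: if the row of $i$ has no vertices, set $\pi(i)=i$; otherwise travel from label $i$ west as far as possible (to the leftmost vertex of the row), then follow edges south and east, starting with south and turning at every new vertex encountered, until a label $j$ is reached; set $\pi(i)=j$. If $i$ labels a horizontal step: travel from label $i$ north as far as possible (to the topmost vertex of the column), then follow edges east and south, starting with east and turning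 at every new vertex encountered, until a label $j$ is reached; set $\pi(i)=j$. **Permutation statistics.** For $\pi=a_1a_2\cdots a_n\in\mathcal{S}_n$, a weak excedance bottom is an $i$ with $a_i\ge i$, and $\mathrm{wex}(\pi)$ is the number of such $i$. Let $A_{EE}(i)=\{j: j<i\le a_i<a_j\}$, $A_{NN}(i)=\{j: a_j<a_i<i<j\}$, $A_{EN}(i)=\{j: j\le a_j<a_i<i\}$, $A_{NE}(i)=\{j: a_i<i<j\le a_j\}$, $C_{EE}(i)=\{j: j<i\le a_j<a_i\}$, $C_{NN}(i)=\{j: a_i<a_j<i<j\}$. For each of these six, set $A_{EE}(\pi)=\sum_i|A_{EE}(i)|$, and likewise for the other five. *)

theory Defs
  imports Main "HOL-Combinatorics.Permutations"
begin

text \<open>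
  Rows and columns are numbered from \<open>0\<close>, rows from the top and columns from the left; labels on the
  partition path are numbered from \<open>1\<close>. The surrounding rectangle has \<open>length (shape T)\<close> rows and
  \<open>width T\<close> columns. Rows of length \<open>0\<close> are allowed in \<open>shape T\<close>.
\<close>

record tableau =
  width :: nat
  shape :: "nat list"
  entry :: "nat \<Rightarrow> nat \<Rightarrow> nat"

definition height :: "tableau \<Rightarrow> nat" where
  "height T = length (shape T)"

definition boxes :: "tableau \<Rightarrow> (nat \<times> nat) set" where
  "boxes T = {(r, j). r < height T \<and> j < shape T ! r}"

text \<open>
  The value \<open>2\<close> is required at every position outside the Young diagram, also outside the rectangle,
  so that equal tableaux are represented by equal functions. Only positions inside the rectangle are
  counted in \<open>num_entries\<close> below.
\<close>

definition permutation_tableau :: "tableau \<Rightarrow> bool" where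
  "permutation_tableau T \<longleftrightarrow>
     sorted_wrt (\<ge>) (shape T) \<and>
     (\<forall>l \<in> set (shape T). l \<le> width T) \<and>
     (\<forall>(r, j) \<in> boxes T. entry T r j \<in> {0, 1}) \<and>
     (\<forall>r j. (r, j) \<notin> boxes T \<longrightarrow> entry T r j = 2) \<and>
     (\<forall>j < width T. \<exists>r < height T. entry T r j = 1) \<and>
     \<not> (\<exists>r j. entry T r j = 0 \<and> (\<exists>r' < r. entry T r' j = 1) \<and> (\<exists>j' < j. entry T r j' = 1))"

definition num_entries :: "tableau \<Rightarrow> nat \<Rightarrow> nat" where
  "num_entries T v = card {(r, j). r < height T \<and> j < width T \<and> entry T r j = v}"

definition tableaux :: "nat \<Rightarrow> nat \<Rightarrow> nat \<Rightarrow> nat \<Rightarrow> nat \<Rightarrow> tableau set" where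
  "tableaux n k a b c =
     {T. permutation_tableau T \<and> k \<le> n \<and> height T = k \<and> width T = n - k \<and>
         num_entries T 0 = a \<and> num_entries T 1 = b \<and> num_entries T 2 = c}"

text \<open>
  The partition path as the list of its unit steps. A step is recorded together with the row at whose
  right end it lies (\<open>Vert\<close>) or the column at whose bottom it lies (\<open>Horiz\<close>). In \<open>path_from r x ls\<close>
  the path has reached the point with \<open>r\<close> rows above it and \<open>x\<close> columns to its left, and \<open>ls\<close> are the
  lengths of the remaining rows.
\<close>

datatype path_step = Vert nat | Horiz nat

fun path_from :: "nat \<Rightarrow> nat \<Rightarrow> nat list \<Rightarrow> path_step list" where
  "path_from r x [] = map Horiz (rev [0..<x])"
| "path_from r x (l # ls) = map Horiz (rev [l..<x]) @ Vert r # path_from (Suc r) l ls"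

definition partition_path :: "tableau \<Rightarrow> path_step list" where
  "partition_path T = path_from 0 (width T) (shape T)"

definition step_at :: "tableau \<Rightarrow> nat \<Rightarrow> path_step" where
  "step_at T i = partition_path T ! (i - 1)"

definition label :: "tableau \<Rightarrow> path_step \<Rightarrow> nat" where
  "label T s = Suc (length (takeWhile (\<lambda>s'. s' \<noteq> s) (partition_path T)))"

definition vertical_labels :: "tableau \<Rightarrow> nat set" where
  "vertical_labels T = {i \<in> {1..height T + width T}. \<exists>r. step_at T i = Vert r}"

text \<open>
  The vertices of the diagram are the positions with entry \<open>1\<close>. \<open>travel T d r j\<close> leaves the vertex
  \<open>(r, j)\<close> in direction \<open>d\<close>, turns at every vertex it meets, and returns the path step whose label it
  finally reaches.
\<close>

definition next_east :: "tableau \<Rightarrow> nat \<Rightarrow> nat \<Rightarrow> nat option" where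
  "next_east T r j = find (\<lambda>j'. entry T r j' = 1) [Suc j..<width T]"

definition next_south :: "tableau \<Rightarrow> nat \<Rightarrow> nat \<Rightarrow> nat option" where
  "next_south T r j = find (\<lambda>r'. entry T r' j = 1) [Suc r..<height T]"

lemma next_east_bounds: "next_east T r j = Some j' \<Longrightarrow> j < j' \<and> j' < width T"
  unfolding next_east_def by (auto simp: find_Some_iff)

lemma next_south_bounds: "next_south T r j = Some r' \<Longrightarrow> r < r' \<and> r' < height T"
  unfolding next_south_def by (auto simp: find_Some_iff)

datatype direction = East | South

function travel :: "tableau \<Rightarrow> direction \<Rightarrow> nat \<Rightarrow> nat \<Rightarrow> path_step" where
  "travel T East r j =
     (case next_east T r j of None \<Rightarrow> Vert r | Some j' \<Rightarrow> travel T South r j')"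
| "travel T South r j =
     (case next_south T r j of None \<Rightarrow> Horiz j | Some r' \<Rightarrow> travel T East r' j)"
  by pat_completeness auto
termination
  by (relation "measure (\<lambda>(T, d, r, j). (height T - r) + (width T - j))")
     (auto dest: next_east_bounds next_south_bounds)

definition leftmost :: "tableau \<Rightarrow> nat \<Rightarrow> nat option" where
  "leftmost T r = find (\<lambda>j. entry T r j = 1) [0..<width T]"

definition topmost :: "tableau \<Rightarrow> nat \<Rightarrow> nat option" where
  "topmost T j = find (\<lambda>r. entry T r j = 1) [0..<height T]"

text \<open>
  Permutations of \<open>{1..n}\<close> are functions fixing everything outside \<open>{1..n}\<close>, as in \<open>permutes\<close>.
  The \<open>None\<close> case of a horizontal step does not arise for permutation tableaux.
\<close>

definition Phi :: "tableau \<Rightarrow> nat \<Rightarrow> nat" where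
  "Phi T i =
     (if i \<in> {1..height T + width T} then
        (case step_at T i of
           Vert r \<Rightarrow> (case leftmost T r of None \<Rightarrow> i | Some j \<Rightarrow> label T (travel T South r j))
         | Horiz j \<Rightarrow> (case topmost T j of None \<Rightarrow> i | Some r \<Rightarrow> label T (travel T East r j)))
      else i)"

definition weak_excedance_bottoms :: "nat \<Rightarrow> (nat \<Rightarrow> nat) \<Rightarrow> nat set" where
  "weak_excedance_bottoms n \<pi> = {i \<in> {1..n}. \<pi> i \<ge> i}"

definition wex :: "nat \<Rightarrow> (nat \<Rightarrow> nat) \<Rightarrow> nat" where
  "wex n \<pi> = card (weak_excedance_bottoms n \<pi>)"

definition A_EE :: "nat \<Rightarrow> (nat \<Rightarrow> nat) \<Rightarrow> nat" where
  "A_EE n \<pi> = (\<Sum>i = 1..n. card {j \<in> {1..n}. j < i \<and> i \<le> \<pi> i \<and> \<pi> i < \<pi> j})"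

definition A_NN :: "nat \<Rightarrow> (nat \<Rightarrow> nat) \<Rightarrow> nat" where
  "A_NN n \<pi> = (\<Sum>i = 1..n. card {j \<in> {1..n}. \<pi> j < \<pi> i \<and> \<pi> i < i \<and> i < j})"

definition A_EN :: "nat \<Rightarrow> (nat \<Rightarrow> nat) \<Rightarrow> nat" where
  "A_EN n \<pi> = (\<Sum>i = 1..n. card {j \<in> {1..n}. j \<le> \<pi> j \<and> \<pi> j < \<pi> i \<and> \<pi> i < i})"

definition A_NE :: "nat \<Rightarrow> (nat \<Rightarrow> nat) \<Rightarrow> nat" where
  "A_NE n \<pi> = (\<Sum>i = 1..n. card {j \<in> {1..n}. \<pi> i < i \<and> i < j \<and> j \<le> \<pi> j})"

definition C_EE :: "nat \<Rightarrow> (nat \<Rightarrow> nat) \<Rightarrow> nat" where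
  "C_EE n \<pi> = (\<Sum>i = 1..n. card {j \<in> {1..n}. j < i \<and> i \<le> \<pi> j \<and> \<pi> j < \<pi> i})"

definition C_NN :: "nat \<Rightarrow> (nat \<Rightarrow> nat) \<Rightarrow> nat" where
  "C_NN n \<pi> = (\<Sum>i = 1..n. card {j \<in> {1..n}. \<pi> i < \<pi> j \<and> \<pi> j < i \<and> i < j})"

definition perms :: "nat \<Rightarrow> nat \<Rightarrow> nat \<Rightarrow> nat \<Rightarrow> nat \<Rightarrow> (nat \<Rightarrow> nat) set" where
  "perms n k a b c =
     {\<pi>. \<pi> permutes {1..n} \<and>
         k = wex n \<pi> \<and>
         a = A_EE n \<pi> + A_NN n \<pi> + A_EN n \<pi> \<and>
         b = C_EE n \<pi> + C_NN n \<pi> + (n - k) \<and>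
         c = A_NE n \<pi>}"

end

theory Submission
  imports Defs
begin

text \<open>
  Read the partition path from northeast to southwest and let the tableau grow with it: a vertical step
  adds an empty row at the bottom, a horizontal step adds a column at the left, whose ones are entered
  from bottom to top. A one may be entered exactly in the rows without a \<open>0\<close> below a \<open>1\<close>. On the side
  of permutations, a vertical step appends a fixed point \<open>n\<close>, and a one entered in the row labeled \<open>l\<close>
  exchanges the values at \<open>l\<close> and at the last label \<open>n\<close>, also for the first one of a column, where \<open>n\<close>
  was a fixed point before. The rows that admit a one are those whose label is (the position of) a
  left-to-right maximum, and the exchange is possible if \<open>\<sigma> l < \<sigma> n\<close>. The inverse exchange is
  determined by the permutation, because \<open>l\<close> is the first position with a value greater than that of
  \<open>n\<close> after the exchange. Hence every permutation arises from exactly one tableau. The numbers of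
  \<open>0\<close>s, \<open>1\<close>s and \<open>2\<close>s change in each step as the corresponding statistics do.
\<close>

subsection \<open>Exchanging the last value with a left-to-right maximum\<close>

text \<open>An added one lies in the leftmost column with no one above it, so no path of the diagram
  can enter it from another vertex. Only the path of its row and the path of its column start there,
  and each continues as the other did before, where a new label counts as a fixed point. This is why
  an added one is an exchange of two values. Since values at left-to-right maxima increase, lying
  above the topmost one of the column amounts to having a value smaller than that at the last label.
  The obstacle is that the statistics compare all pairs of positions. They are written as sums over
  ordered pairs, so that only pairs with an exchanged position change. For \<open>C_EE\<close> and
  \<open>C_NN\<close> the changes do not cancel position by position; they cancel in total, because
  a permutation has as many arcs going up across a level as going down. Undoing an exchange raises
  the value at \<open>n\<close>, so surjectivity is proved by induction on \<open>n\<close> and then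
  on \<open>n - \<sigma> n\<close>.\<close>

definition lr_max :: "(nat \<Rightarrow> nat) \<Rightarrow> nat \<Rightarrow> bool" where
  "lr_max \<sigma> p \<longleftrightarrow> (\<forall>j<p. \<sigma> j < \<sigma> p)"

definition swappable :: "nat \<Rightarrow> (nat \<Rightarrow> nat) \<Rightarrow> nat \<Rightarrow> bool" where
  "swappable n \<sigma> l \<longleftrightarrow> \<sigma> permutes {1..n} \<and> l \<in> {1..n} \<and> lr_max \<sigma> l \<and> \<sigma> l < \<sigma> n"

abbreviation swap_with_last :: "nat \<Rightarrow> (nat \<Rightarrow> nat) \<Rightarrow> nat \<Rightarrow> nat \<Rightarrow> nat" where
  "swap_with_last n \<sigma> l \<equiv> \<sigma> \<circ> transpose l n"

text \<open>The \<open>p\<close> distinct values at the positions before \<open>p\<close> all lie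
  below \<open>\<sigma> p\<close>.\<close>

lemma lr_max_ge:
  assumes "inj \<sigma>" "lr_max \<sigma> p"
  shows "p \<le> \<sigma> p"
proof -
  have "card (\<sigma> ` {..<p}) \<le> card {..<\<sigma> p}"
    using assms(2) by (intro card_mono) (auto simp: lr_max_def)
  then show ?thesis
    using assms(1) by (simp add: card_image inj_on_subset)
qed

lemma permutes_atLeastAtMost_bounds:
  fixes \<sigma> :: "nat \<Rightarrow> nat"
  assumes "\<sigma> permutes {1..n}"
  shows "\<sigma> i \<le> n \<longleftrightarrow> i \<le> n" "0 < \<sigma> i \<longleftrightarrow> 0 < i"
proof -
  have "\<sigma> i \<in> {1..n} \<longleftrightarrow> i \<in> {1..n}" and "i \<notin> {1..n} \<longrightarrow> \<sigma> i = i"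
    using permutes_in_image[OF assms, of i] permutes_not_in[OF assms, of i] by auto
  then show "\<sigma> i \<le> n \<longleftrightarrow> i \<le> n" "0 < \<sigma> i \<longleftrightarrow> 0 < i"
    by (cases "i \<in> {1..n}"; auto)+
qed

lemma swappable_facts:
  assumes "swappable n \<sigma> l"
  shows "\<sigma> permutes {1..n}" "inj \<sigma>" "1 \<le> l" "l < n" "l \<le> \<sigma> l" "\<sigma> l < \<sigma> n" "\<sigma> n \<le> n"
    "lr_max \<sigma> l"
  using assms lr_max_ge[of \<sigma> l] permutes_inj[of \<sigma> "{1..n}"]
    permutes_atLeastAtMost_bounds[of \<sigma> n n]
  by (auto simp: swappable_def intro: le_neq_trans)

lemma permutes_swap_with_last:
  "swappable n \<sigma> l \<Longrightarrow> swap_with_last n \<sigma> l permutes {1..n}"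
  using swappable_facts(4)[of n \<sigma> l]
  by (auto simp: swappable_def intro!: permutes_compose permutes_swap_id)

text \<open>Recovers \<open>l\<close> from the permutation after the exchange.\<close>

lemma swap_with_last_least:
  assumes "swappable n \<sigma> l"
  defines "\<tau> \<equiv> swap_with_last n \<sigma> l"
  shows "\<tau> n < \<tau> l" "j < l \<Longrightarrow> \<tau> j < \<tau> n"
  using swappable_facts[OF assms(1)] by (auto simp: \<tau>_def transpose_def lr_max_def)

text \<open>The exchange raises the value at \<open>l\<close> to \<open>\<sigma> n\<close>.
  Positions before \<open>l\<close> do not see this, \<open>l\<close> itself stays a maximum, and a
  later maximum survives exactly if it also exceeds the raised value.\<close>

lemma swap_with_last_lr_max:
  assumes "swappable n \<sigma> l" "p < n"
  shows "lr_max (swap_with_last n \<sigma> l) p \<longleftrightarrow> lr_max \<sigma> p \<and> (p \<le> l \<or> \<sigma> n < \<sigma> p)"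
proof -
  note f = swappable_facts[OF assms(1)]
  let ?\<tau> = "swap_with_last n \<sigma> l"
  have \<tau>: "?\<tau> j = (if j = l then \<sigma> n else \<sigma> j)" if "j < n" for j
    using that by (auto simp: transpose_def)
  consider "p < l" | "p = l" | "l < p" by linarith
  then show ?thesis
  proof cases
    case 1
    then show ?thesis using assms(2) by (auto simp: lr_max_def \<tau>)
  next
    case 2
    then show ?thesis using assms(2) f by (auto simp: lr_max_def \<tau> intro: less_trans)
  next
    case 3
    have "(\<forall>j<p. ?\<tau> j < \<sigma> p) \<longleftrightarrow> (\<forall>j<p. \<sigma> j < \<sigma> p) \<and> \<sigma> n < \<sigma> p"
    proof safe
      fix j assume a: "\<forall>j<p. ?\<tau> j < \<sigma> p" "j < p"
      then have "?\<tau> l < \<sigma> p" "?\<tau> j < \<sigma> p" using 3 by blast+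
      then show "\<sigma> j < \<sigma> p"
        using f(6) a(2) assms(2) 3 by (simp add: \<tau> del: comp_apply split: if_splits)
    next
      assume "\<forall>j<p. ?\<tau> j < \<sigma> p"
      then show "\<sigma> n < \<sigma> p" using 3 by force
    next
      fix j assume a: "\<forall>j<p. \<sigma> j < \<sigma> p" "\<sigma> n < \<sigma> p" "j < p"
      then show "?\<tau> j < \<sigma> p" using assms(2) by (simp add: \<tau> del: comp_apply)
    qed
    then show ?thesis using 3 assms(2) by (simp add: lr_max_def \<tau> del: comp_apply)
  qed
qed

lemma swap_with_last_cancel:
  assumes "swap_with_last n \<sigma> l = swap_with_last n \<sigma>' l'" "swappable n \<sigma> l" "swappable n \<sigma>' l'"
  shows "l = l' \<and> \<sigma> = \<sigma>'"
proof -
  have "l = l'"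
    using swap_with_last_least[OF assms(2)] swap_with_last_least[OF assms(3)] assms(1)
    by (metis less_asym linorder_neqE_nat)
  moreover have "\<sigma> = swap_with_last n \<sigma> l \<circ> transpose l n" for \<sigma> :: "nat \<Rightarrow> nat" and l
    by (simp add: comp_assoc)
  ultimately show ?thesis using assms(1) by metis
qed

text \<open>The conclusion \<open>\<tau> n < \<sigma> n\<close> is what makes the measure in
  \<open>Phi_surjective\<close> decrease.\<close>

lemma swap_with_last_exists:
  assumes "\<tau> permutes {1..n}" "\<tau> n < n"
  obtains \<sigma> l where "swappable n \<sigma> l" "\<tau> = swap_with_last n \<sigma> l" "\<tau> n < \<sigma> n"
proof -
  define l where "l = (LEAST i. \<tau> n < \<tau> i)"
  have *: "\<tau> n < \<tau> (inv \<tau> n)"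
    using assms by (simp add: permutes_inverses)
  have l: "\<tau> n < \<tau> l" unfolding l_def by (rule LeastI[where P="\<lambda>i. \<tau> n < \<tau> i", OF *])
  have least: "\<tau> j < \<tau> n" if "j < l" for j
  proof -
    have "\<not> \<tau> n < \<tau> j" using that not_less_Least unfolding l_def by blast
    \<comment> \<open>The value \<open>n\<close> is taken at a position at most \<open>n\<close>, so
      \<open>j < l\<close> excludes \<open>j = n\<close>, and injectivity makes the inequality
      strict.\<close>
    moreover have "l \<le> inv \<tau> n" unfolding l_def using * by (rule Least_le)
    moreover have "inv \<tau> n \<le> n"
      using permutes_atLeastAtMost_bounds[OF permutes_inv[OF assms(1)], of n] by simp
    ultimately show ?thesis
      using that permutes_inj[OF assms(1)] by (metis inj_eq leD le_less_trans linorder_neqE_nat less_le_trans)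
  qed
  have "l \<noteq> n" using l by auto
  have "0 < l" using l permutes_atLeastAtMost_bounds(2)[OF assms(1), of l] by linarith
  moreover have "l \<le> n"
  proof (rule ccontr)
    assume "\<not> l \<le> n"
    then show False using least[of n] by simp
  qed
  ultimately have ln: "l \<in> {1..n}" "n \<in> {1..n}" using \<open>l \<noteq> n\<close> by auto
  let ?\<sigma> = "\<tau> \<circ> transpose l n"
  have "?\<sigma> permutes {1..n}" using ln assms by (intro permutes_compose permutes_swap_id) auto
  moreover have "lr_max ?\<sigma> l"
    using least ln by (auto simp: lr_max_def transpose_def)
  ultimately have "swappable n ?\<sigma> l" using l ln by (auto simp: swappable_def)
  moreover have "\<tau> = swap_with_last n ?\<sigma> l" by (simp add: comp_assoc)
  moreover have "\<tau> n < ?\<sigma> n" using l by simp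
  ultimately show ?thesis by (rule that)
qed

text \<open>The value at \<open>l\<close> only rises, and the value at \<open>n\<close> drops to
  \<open>\<sigma> l < n\<close>.\<close>

lemma weak_excedance_bottoms_swap:
  assumes "swappable n \<sigma> l"
  shows "weak_excedance_bottoms n (swap_with_last n \<sigma> l) = weak_excedance_bottoms n \<sigma> - {n}"
  using swappable_facts[OF assms]
  by (auto simp: weak_excedance_bottoms_def transpose_def)

lemma weak_excedance_bottoms_Suc:
  assumes "\<sigma> permutes {1..n}"
  shows "weak_excedance_bottoms (Suc n) \<sigma> = insert (Suc n) (weak_excedance_bottoms n \<sigma>)"
  using permutes_not_in[OF assms, of "Suc n"] by (auto simp: weak_excedance_bottoms_def le_Suc_eq)

subsection \<open>The change of the statistics under an exchange\<close>

text \<open>The contribution of one ordered pair of points \<open>(i, a)\<close> and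
  \<open>(j, b)\<close> of the graph of a permutation. It is an integer because the effect of an
  exchange is expressed by differences.\<close>

definition A_pair :: "nat \<Rightarrow> nat \<Rightarrow> nat \<Rightarrow> nat \<Rightarrow> int" where
  "A_pair i a j b = of_bool (j < i \<and> i \<le> a \<and> a < b) + of_bool (b < a \<and> a < i \<and> i < j)
     + of_bool (j \<le> b \<and> b < a \<and> a < i)"

definition C_pair :: "nat \<Rightarrow> nat \<Rightarrow> nat \<Rightarrow> nat \<Rightarrow> int" where
  "C_pair i a j b = of_bool (j < i \<and> i \<le> b \<and> b < a) + of_bool (a < b \<and> b < i \<and> i < j)"

definition NE_pair :: "nat \<Rightarrow> nat \<Rightarrow> nat \<Rightarrow> nat \<Rightarrow> int" where
  "NE_pair i a j b = of_bool (a < i \<and> i < j \<and> j \<le> b)"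

text \<open>
  In the next three lemmas \<open>x\<close> and \<open>y\<close> are the values at \<open>l\<close> and \<open>n\<close> before the exchange, and \<open>b\<close>
  is the value at another position \<open>j\<close>.
\<close>

lemma A_pair_exchange:
  fixes l x y n j b :: nat
  assumes "l \<le> x" "x < y" "y \<le> n" "b \<noteq> x" "b \<noteq> y" "j < l \<Longrightarrow> b < x" "j \<noteq> l" "j < n" "b \<le> n"
  shows "A_pair l y j b + A_pair j b l y + A_pair n x j b + A_pair j b n x
       - (A_pair l x j b + A_pair j b l x + A_pair n y j b + A_pair j b n y)
     = of_bool (y = n \<and> j \<le> b)"
proof -
  \<comment> \<open>These are the relative orders left by the maximum at \<open>l\<close> and by the
    distinctness of the values; in each of them the indicators can be decided.\<close>
  have "j < l \<and> b < x \<or> l < j \<and> (b < x \<or> x < b \<and> b < y \<or> y < b)"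
    "j \<le> b \<or> b < j" "j \<le> x \<or> x < j" "j \<le> y \<or> y < j" "y = n \<or> y < n"
    using assms by linarith+
  then show ?thesis
    using \<open>l \<le> x\<close> \<open>x < y\<close> \<open>j < n\<close> \<open>b \<le> n\<close> unfolding A_pair_def
    by (elim disjE conjE; simp)
qed

lemma C_pair_exchange:
  fixes l x y n j b :: nat
  assumes "l \<le> x" "x < y" "y \<le> n" "b \<noteq> x" "b \<noteq> y" "j < l \<Longrightarrow> b < x" "j \<noteq> l" "j < n" "b \<le> n"
  shows "C_pair l y j b + C_pair j b l y + C_pair n x j b + C_pair j b n x
       - (C_pair l x j b + C_pair j b l x + C_pair n y j b + C_pair j b n y)
     = of_bool (j \<le> y \<and> y < b) - of_bool (b \<le> y \<and> y < j)
        - (of_bool (j \<le> x \<and> x < b) - of_bool (b \<le> x \<and> x < j))"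
proof -
  have "j < l \<and> b < x \<or> l < j \<and> (b < x \<or> x < b \<and> b < y \<or> y < b)"
    "j \<le> b \<or> b < j" "j \<le> x \<or> x < j" "j \<le> y \<or> y < j" "y = n \<or> y < n"
    using assms by linarith+
  then show ?thesis
    using \<open>l \<le> x\<close> \<open>x < y\<close> \<open>j < n\<close> \<open>b \<le> n\<close> unfolding C_pair_def
    by (elim disjE conjE; simp)
qed

lemma NE_pair_exchange:
  fixes l x y n j b :: nat
  assumes "l \<le> x" "x < y" "y \<le> n" "b \<noteq> x" "b \<noteq> y" "j < l \<Longrightarrow> b < x" "j \<noteq> l" "j < n" "b \<le> n"
  shows "NE_pair l y j b + NE_pair j b l y + NE_pair n x j b + NE_pair j b n x
       - (NE_pair l x j b + NE_pair j b l x + NE_pair n y j b + NE_pair j b n y)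
     = - of_bool (y = n \<and> b < j)"
proof -
  have "j < l \<and> b < x \<or> l < j \<and> (b < x \<or> x < b \<and> b < y \<or> y < b)"
    "j \<le> b \<or> b < j" "j \<le> x \<or> x < j" "j \<le> y \<or> y < j" "y = n \<or> y < n"
    using assms by linarith+
  then show ?thesis
    using \<open>l \<le> x\<close> \<open>x < y\<close> \<open>j < n\<close> \<open>b \<le> n\<close> unfolding NE_pair_def
    by (elim disjE conjE; simp)
qed

definition pair_sum :: "(nat \<Rightarrow> nat \<Rightarrow> nat \<Rightarrow> nat \<Rightarrow> int) \<Rightarrow> nat \<Rightarrow> (nat \<Rightarrow> nat) \<Rightarrow> int" where
  "pair_sum F n \<sigma> = (\<Sum>i\<in>{1..n}. \<Sum>j\<in>{1..n}. F i (\<sigma> i) j (\<sigma> j))"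

lemma int_sum_card:
  "int (\<Sum>i = 1..n::nat. card {j \<in> {1..n::nat}. P i j}) = (\<Sum>i = 1..n. \<Sum>j = 1..n. of_bool (P i j))"
  by (simp add: sum_of_bool_eq Int_def conj_commute cong: conj_cong)

lemma statistics_pair_sum:
  "int (A_EE n \<sigma> + A_NN n \<sigma> + A_EN n \<sigma>) = pair_sum A_pair n \<sigma>"
  "int (C_EE n \<sigma> + C_NN n \<sigma>) = pair_sum C_pair n \<sigma>"
  "int (A_NE n \<sigma>) = pair_sum NE_pair n \<sigma>"
  unfolding A_EE_def A_NN_def A_EN_def A_NE_def C_EE_def C_NN_def of_nat_add int_sum_card
    pair_sum_def A_pair_def C_pair_def NE_pair_def
  by (simp_all only: sum.distrib)

text \<open>Terms of two other positions cancel. What remains are the terms between another position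
  \<open>j\<close> and the exchanged ones, which the exchange lemmas above evaluate, and the four
  terms within \<open>{l, n}\<close>.\<close>

lemma pair_sum_swap:
  fixes \<sigma> :: "nat \<Rightarrow> nat"
  assumes "l \<in> {1..n}" "l \<noteq> n"
  defines "x \<equiv> \<sigma> l" and "y \<equiv> \<sigma> n"
  shows "pair_sum F n (swap_with_last n \<sigma> l) - pair_sum F n \<sigma> =
    (\<Sum>j\<in>{1..n} - {l, n}.
       F l y j (\<sigma> j) + F j (\<sigma> j) l y + F n x j (\<sigma> j) + F j (\<sigma> j) n x
       - (F l x j (\<sigma> j) + F j (\<sigma> j) l x + F n y j (\<sigma> j) + F j (\<sigma> j) n y))
    + (F l y l y + F l y n x + F n x l y + F n x n x)
    - (F l x l x + F l x n y + F n y l x + F n y n y)"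
proof -
  let ?R = "{1..n} - {l, n}"
  have I: "{1..n} = insert l (insert n ?R)" using assms by auto
  have ne: "l \<notin> insert n ?R" "n \<notin> ?R" using assms by auto
  have split: "(\<Sum>i\<in>{1..n}. \<Sum>j\<in>{1..n}. f i j) =
     (\<Sum>i\<in>?R. \<Sum>j\<in>?R. f i j) + (\<Sum>j\<in>?R. f l j + f j l + f n j + f j n)
     + (f l l + f l n + f n l + f n n)" for f :: "nat \<Rightarrow> nat \<Rightarrow> int"
    apply (subst (1 2) I)
    using ne by (simp add: sum.distrib algebra_simps)
  let ?\<tau> = "swap_with_last n \<sigma> l"
  have \<tau>: "?\<tau> j = \<sigma> j" if "j \<in> ?R" for j using that by (auto simp: transpose_def)
  have "pair_sum F n ?\<tau> = (\<Sum>i\<in>?R. \<Sum>j\<in>?R. F i (\<sigma> i) j (\<sigma> j))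
     + (\<Sum>j\<in>?R. F l y j (\<sigma> j) + F j (\<sigma> j) l y + F n x j (\<sigma> j) + F j (\<sigma> j) n x)
     + (F l y l y + F l y n x + F n x l y + F n x n x)"
    unfolding pair_sum_def by (subst split) (simp add: \<tau> x_def y_def del: comp_apply cong: sum.cong, simp)
  moreover have "pair_sum F n \<sigma> = (\<Sum>i\<in>?R. \<Sum>j\<in>?R. F i (\<sigma> i) j (\<sigma> j))
     + (\<Sum>j\<in>?R. F l x j (\<sigma> j) + F j (\<sigma> j) l x + F n y j (\<sigma> j) + F j (\<sigma> j) n y)
     + (F l x l x + F l x n y + F n y l x + F n y n y)"
    unfolding pair_sum_def by (subst split) (simp add: x_def y_def)
  ultimately show ?thesis by (simp add: sum_subtractf)
qed

lemma pair_sum_Suc: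
  assumes "\<sigma> permutes {1..n}"
  shows "pair_sum F (Suc n) \<sigma> = pair_sum F n \<sigma>
    + (\<Sum>j=1..n. F (Suc n) (Suc n) j (\<sigma> j) + F j (\<sigma> j) (Suc n) (Suc n)) + F (Suc n) (Suc n) (Suc n) (Suc n)"
proof -
  have "\<sigma> (Suc n) = Suc n" using permutes_not_in[OF assms] by simp
  then show ?thesis unfolding pair_sum_def by (simp add: sum.distrib algebra_simps)
qed

text \<open>As many positions as values are at most \<open>x\<close>, so equally many arcs from
  \<open>i\<close> to \<open>\<sigma> i\<close> cross the level \<open>x\<close> upwards and
  downwards. This makes the right-hand side of \<open>C_pair_exchange\<close> collapse in the sum
  over all positions.\<close>

lemma card_exceed_eq:
  fixes \<sigma> :: "nat \<Rightarrow> nat"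
  assumes "\<sigma> permutes {1..n}"
  shows "(\<Sum>i=1..n. of_bool (i \<le> x \<and> x < \<sigma> i) - of_bool (\<sigma> i \<le> x \<and> x < i)) = (0::int)"
proof -
  have "(\<Sum>i=1..n. of_bool (i \<le> x \<and> x < \<sigma> i) - of_bool (\<sigma> i \<le> x \<and> x < i)) =
      (\<Sum>i=1..n. of_bool (i \<le> x) :: int) - (\<Sum>i=1..n. of_bool (\<sigma> i \<le> x))"
    unfolding sum_subtractf[symmetric] by (intro sum.cong) (auto simp: of_bool_def)
  also have "(\<Sum>i=1..n. of_bool (\<sigma> i \<le> x) :: int) = (\<Sum>i=1..n. of_bool (i \<le> x))"
    using sum.permute[OF assms, of "\<lambda>i. of_bool (i \<le> x) :: int"] by (simp add: comp_def)
  finally show ?thesis by simp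
qed


lemma wex_eq_sum: "int (wex n \<sigma>) = (\<Sum>j=1..n. of_bool (j \<le> \<sigma> j))"
  by (simp add: wex_def weak_excedance_bottoms_def Int_def)

section \<open>Pair sums after appending a fixed point and after an exchange\<close>

lemma pair_sum_Suc_A:
  assumes "\<sigma> permutes {1..n}"
  shows "pair_sum A_pair (Suc n) \<sigma> = pair_sum A_pair n \<sigma>"
  unfolding pair_sum_Suc[OF assms]
  using permutes_atLeastAtMost_bounds(1)[OF assms, THEN iffD2]
  by (fastforce simp: A_pair_def intro!: sum.neutral)

lemma pair_sum_Suc_C:
  assumes "\<sigma> permutes {1..n}"
  shows "pair_sum C_pair (Suc n) \<sigma> = pair_sum C_pair n \<sigma>"
  unfolding pair_sum_Suc[OF assms]
  using permutes_atLeastAtMost_bounds(1)[OF assms, THEN iffD2]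
  by (fastforce simp: C_pair_def intro!: sum.neutral)

text \<open>Each of the \<open>n - wex n \<sigma>\<close> positions with a smaller value forms one
  pair with the new fixed point. The tableau gains as many 2s, one per column, in its new empty
  row.\<close>

lemma pair_sum_Suc_NE:
  assumes "\<sigma> permutes {1..n}"
  shows "pair_sum NE_pair (Suc n) \<sigma> = pair_sum NE_pair n \<sigma> + int n - int (wex n \<sigma>)"
proof -
  have "(\<Sum>j=1..n. NE_pair (Suc n) (Suc n) j (\<sigma> j) + NE_pair j (\<sigma> j) (Suc n) (Suc n))
      = (\<Sum>j=1..n. 1 - of_bool (j \<le> \<sigma> j))"
    by (intro sum.cong) (auto simp: NE_pair_def)
  also have "\<dots> = int n - int (wex n \<sigma>)"
    unfolding wex_eq_sum sum_subtractf by simp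
  finally show ?thesis
    unfolding pair_sum_Suc[OF assms] by (simp add: NE_pair_def)
qed

context
  fixes n \<sigma> l
  assumes sw: "swappable n \<sigma> l"
begin

private abbreviation (input) "R \<equiv> {1..n} - {l, n}"

private lemma other_values:
  assumes "j \<in> R"
  shows "\<sigma> j \<noteq> \<sigma> l" "\<sigma> j \<noteq> \<sigma> n" "j < l \<Longrightarrow> \<sigma> j < \<sigma> l" "j \<noteq> l" "j < n" "\<sigma> j \<le> n"
  using assms swappable_facts[OF sw] permutes_atLeastAtMost_bounds(1)[of \<sigma> n j]
  by (auto simp: inj_eq lr_max_def)

private lemma swap:
  "pair_sum F n (swap_with_last n \<sigma> l) - pair_sum F n \<sigma> =
    (\<Sum>j\<in>{1..n} - {l, n}.
       F l (\<sigma> n) j (\<sigma> j) + F j (\<sigma> j) l (\<sigma> n) + F n (\<sigma> l) j (\<sigma> j) + F j (\<sigma> j) n (\<sigma> l)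
       - (F l (\<sigma> l) j (\<sigma> j) + F j (\<sigma> j) l (\<sigma> l) + F n (\<sigma> n) j (\<sigma> j) + F j (\<sigma> j) n (\<sigma> n)))
    + (F l (\<sigma> n) l (\<sigma> n) + F l (\<sigma> n) n (\<sigma> l) + F n (\<sigma> l) l (\<sigma> n) + F n (\<sigma> l) n (\<sigma> l))
    - (F l (\<sigma> l) l (\<sigma> l) + F l (\<sigma> l) n (\<sigma> n) + F n (\<sigma> n) l (\<sigma> l) + F n (\<sigma> n) n (\<sigma> n))"
  using swappable_facts[OF sw] by (intro pair_sum_swap) auto

private lemma sum_R: "(\<Sum>j\<in>{1..n}. f j) = f l + f n + (\<Sum>j\<in>R. f j)" for f :: "nat \<Rightarrow> int"
proof -
  have "{1..n} = insert l (insert n R)" using swappable_facts[OF sw] by auto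
  then have "(\<Sum>j\<in>{1..n}. f j) = (\<Sum>j\<in>insert l (insert n R). f j)" by simp
  also have "\<dots> = f l + f n + (\<Sum>j\<in>R. f j)" using swappable_facts[OF sw] by simp
  finally show ?thesis .
qed

text \<open>For \<open>\<sigma> n = n\<close> every weak excedance bottom other than
  \<open>l\<close> and \<open>n\<close> adds one pair; these match the zeros of a new column with a
  single one. For \<open>\<sigma> n < n\<close> the other positions contribute nothing in total, and
  the pair of \<open>n\<close> with \<open>l\<close>, counted by \<open>A_EN\<close>, is lost, just
  as a zero turns into a one.\<close>

lemma pair_sum_swap_A:
  "pair_sum A_pair n (swap_with_last n \<sigma> l) =
    pair_sum A_pair n \<sigma> + (if \<sigma> n = n then int (wex n \<sigma>) - 2 else - 1)"
proof (cases "\<sigma> n = n")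
  case True
  note f = swappable_facts[OF sw]
  have "(\<Sum>j\<in>R. A_pair l (\<sigma> n) j (\<sigma> j) + A_pair j (\<sigma> j) l (\<sigma> n) + A_pair n (\<sigma> l) j (\<sigma> j) + A_pair j (\<sigma> j) n (\<sigma> l)
       - (A_pair l (\<sigma> l) j (\<sigma> j) + A_pair j (\<sigma> j) l (\<sigma> l) + A_pair n (\<sigma> n) j (\<sigma> j) + A_pair j (\<sigma> j) n (\<sigma> n)))
     = (\<Sum>j\<in>R. of_bool (j \<le> \<sigma> j))"
  proof (rule sum.cong[OF refl])
    fix j assume "j \<in> R"
    from A_pair_exchange[OF f(5-7) other_values[OF this]]
    show "A_pair l (\<sigma> n) j (\<sigma> j) + A_pair j (\<sigma> j) l (\<sigma> n) + A_pair n (\<sigma> l) j (\<sigma> j) + A_pair j (\<sigma> j) n (\<sigma> l)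
       - (A_pair l (\<sigma> l) j (\<sigma> j) + A_pair j (\<sigma> j) l (\<sigma> l) + A_pair n (\<sigma> n) j (\<sigma> j) + A_pair j (\<sigma> j) n (\<sigma> n))
      = of_bool (j \<le> \<sigma> j)"
      by (simp add: True)
  qed
  also have "\<dots> = int (wex n \<sigma>) - 2"
    unfolding wex_eq_sum sum_R using swappable_facts(4-6)[OF sw] True by simp
  finally show ?thesis
    using swap[of A_pair] swappable_facts(4-6)[OF sw] True by (auto simp: A_pair_def)
next
  case False
  note f = swappable_facts[OF sw]
  have "(\<Sum>j\<in>R. A_pair l (\<sigma> n) j (\<sigma> j) + A_pair j (\<sigma> j) l (\<sigma> n) + A_pair n (\<sigma> l) j (\<sigma> j) + A_pair j (\<sigma> j) n (\<sigma> l)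
       - (A_pair l (\<sigma> l) j (\<sigma> j) + A_pair j (\<sigma> j) l (\<sigma> l) + A_pair n (\<sigma> n) j (\<sigma> j) + A_pair j (\<sigma> j) n (\<sigma> n)))
     = 0"
  proof (rule sum.neutral, rule ballI)
    fix j assume "j \<in> R"
    from A_pair_exchange[OF f(5-7) other_values[OF this]]
    show "A_pair l (\<sigma> n) j (\<sigma> j) + A_pair j (\<sigma> j) l (\<sigma> n) + A_pair n (\<sigma> l) j (\<sigma> j) + A_pair j (\<sigma> j) n (\<sigma> l)
       - (A_pair l (\<sigma> l) j (\<sigma> j) + A_pair j (\<sigma> j) l (\<sigma> l) + A_pair n (\<sigma> n) j (\<sigma> j) + A_pair j (\<sigma> j) n (\<sigma> n))
      = 0"
      by (simp add: False)
  qed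
  then show ?thesis
    using swap[of A_pair] swappable_facts(4-7)[OF sw] False by (auto simp: A_pair_def)
qed

text \<open>The increment is missing only while \<open>n\<close> is a fixed point, that is, for the
  first one of a column. That one is accounted for by the number of columns.\<close>

lemma pair_sum_swap_C:
  "pair_sum C_pair n (swap_with_last n \<sigma> l) = pair_sum C_pair n \<sigma> + of_bool (\<sigma> n < n)"
proof -
  note f = swappable_facts[OF sw]
  let ?e = "\<lambda>x i. of_bool (i \<le> x \<and> x < \<sigma> i) - of_bool (\<sigma> i \<le> x \<and> x < i) :: int"
  have "(\<Sum>j\<in>R. C_pair l (\<sigma> n) j (\<sigma> j) + C_pair j (\<sigma> j) l (\<sigma> n) + C_pair n (\<sigma> l) j (\<sigma> j) + C_pair j (\<sigma> j) n (\<sigma> l)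
       - (C_pair l (\<sigma> l) j (\<sigma> j) + C_pair j (\<sigma> j) l (\<sigma> l) + C_pair n (\<sigma> n) j (\<sigma> j) + C_pair j (\<sigma> j) n (\<sigma> n)))
     = (\<Sum>j\<in>R. ?e (\<sigma> n) j - ?e (\<sigma> l) j)"
  proof (rule sum.cong[OF refl])
    fix j assume "j \<in> R"
    from C_pair_exchange[OF f(5-7) other_values[OF this]]
    show "C_pair l (\<sigma> n) j (\<sigma> j) + C_pair j (\<sigma> j) l (\<sigma> n) + C_pair n (\<sigma> l) j (\<sigma> j) + C_pair j (\<sigma> j) n (\<sigma> l)
       - (C_pair l (\<sigma> l) j (\<sigma> j) + C_pair j (\<sigma> j) l (\<sigma> l) + C_pair n (\<sigma> n) j (\<sigma> j) + C_pair j (\<sigma> j) n (\<sigma> n))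
      = ?e (\<sigma> n) j - ?e (\<sigma> l) j"
      by simp
  qed
  also have "\<dots> = (\<Sum>j\<in>R. ?e (\<sigma> n) j) - (\<Sum>j\<in>R. ?e (\<sigma> l) j)"
    by (rule sum_subtractf)
  \<comment> \<open>Over all positions both sums vanish by \<open>card_exceed_eq\<close>. Of the
    terms at \<open>l\<close> and \<open>n\<close>, only the arc from \<open>n\<close> down to
    \<open>\<sigma> n\<close>, taken at level \<open>\<sigma> n\<close>, can be nonzero.\<close>
  also have "\<dots> = of_bool (\<sigma> n < n)"
    using card_exceed_eq[OF f(1), of "\<sigma> n"] card_exceed_eq[OF f(1), of "\<sigma> l"] f(4-7)
    unfolding sum_R by (cases "\<sigma> n = n") (simp_all add: le_neq_trans del: sum_of_bool_eq sum_subtractf)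
  finally show ?thesis
    using swap[of C_pair] f(4-7) by (auto simp: C_pair_def)
qed

text \<open>A fixed point \<open>n\<close> forms a pair with every position of smaller value, and
  loses all these pairs when its own value drops. This cancels the gain in
  \<open>pair_sum_Suc_NE\<close>, in accordance with a new column adding no 2s.\<close>

lemma pair_sum_swap_NE:
  "pair_sum NE_pair n (swap_with_last n \<sigma> l) =
    pair_sum NE_pair n \<sigma> - (if \<sigma> n = n then int n - int (wex n \<sigma>) else 0)"
proof -
  note f = swappable_facts[OF sw]
  have "(\<Sum>j\<in>R. NE_pair l (\<sigma> n) j (\<sigma> j) + NE_pair j (\<sigma> j) l (\<sigma> n) + NE_pair n (\<sigma> l) j (\<sigma> j) + NE_pair j (\<sigma> j) n (\<sigma> l)
       - (NE_pair l (\<sigma> l) j (\<sigma> j) + NE_pair j (\<sigma> j) l (\<sigma> l) + NE_pair n (\<sigma> n) j (\<sigma> j) + NE_pair j (\<sigma> j) n (\<sigma> n)))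
     = (\<Sum>j\<in>R. if \<sigma> n = n then of_bool (j \<le> \<sigma> j) - 1 else 0)"
  proof (rule sum.cong[OF refl])
    fix j assume "j \<in> R"
    from NE_pair_exchange[OF f(5-7) other_values[OF this]]
    show "NE_pair l (\<sigma> n) j (\<sigma> j) + NE_pair j (\<sigma> j) l (\<sigma> n) + NE_pair n (\<sigma> l) j (\<sigma> j) + NE_pair j (\<sigma> j) n (\<sigma> l)
       - (NE_pair l (\<sigma> l) j (\<sigma> j) + NE_pair j (\<sigma> j) l (\<sigma> l) + NE_pair n (\<sigma> n) j (\<sigma> j) + NE_pair j (\<sigma> j) n (\<sigma> n))
      = (if \<sigma> n = n then of_bool (j \<le> \<sigma> j) - 1 else 0)"
      by (simp add: of_bool_def not_le)
  qed
  also have "\<dots> = (if \<sigma> n = n then (\<Sum>j\<in>{1..n}. of_bool (j \<le> \<sigma> j) - 1) else 0)"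
    unfolding sum_R using f(4-7) by auto
  also have "\<dots> = - (if \<sigma> n = n then int n - int (wex n \<sigma>) else 0)"
    unfolding wex_eq_sum sum_subtractf by simp
  finally show ?thesis
    using swap[of NE_pair] f(4-7) by (auto simp: NE_pair_def)
qed

end

subsection \<open>Growing tableaux\<close>

definition unrestricted :: "tableau \<Rightarrow> nat \<Rightarrow> bool" where
  "unrestricted T r \<longleftrightarrow> \<not> (\<exists>j. entry T r j = 0 \<and> (\<exists>r' < r. entry T r' j = 1))"

definition empty_tableau :: tableau where
  "empty_tableau = \<lparr>width = 0, shape = [], entry = \<lambda>_ _. 2\<rparr>"

text \<open>\<open>entry\<close> stays as it is, since positions outside the diagram carry the value
  2 already.\<close>

definition add_row :: "tableau \<Rightarrow> tableau" where
  "add_row T = T\<lparr>shape := shape T @ [0]\<rparr>"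

text \<open>The column comes with its lowest one, because a column without a one would violate the
  definition of a permutation tableau.\<close>

definition add_column :: "nat \<Rightarrow> tableau \<Rightarrow> tableau" where
  "add_column r T = \<lparr>width = Suc (width T), shape = map Suc (shape T),
     entry = (\<lambda>r' j. case j of 0 \<Rightarrow> if r' < height T then of_bool (r' = r) else 2 | Suc j' \<Rightarrow> entry T r' j')\<rparr>"

definition add_one :: "nat \<Rightarrow> tableau \<Rightarrow> tableau" where
  "add_one r T = T\<lparr>entry := (\<lambda>r' j. if r' = r \<and> j = 0 then 1 else entry T r' j)\<rparr>"

text \<open>The last step of the partition path is horizontal.\<close>

definition closed :: "tableau \<Rightarrow> bool" where
  "closed T \<longleftrightarrow> 0 < width T \<and> 0 \<notin> set (shape T)"

text \<open>\<open>closed\<close> provides a box in column 0. The last conjunct makes the new one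
  the topmost of its column, so that no edge leads into it.\<close>

definition one_addable :: "nat \<Rightarrow> tableau \<Rightarrow> bool" where
  "one_addable r T \<longleftrightarrow> r < height T \<and> unrestricted T r \<and> closed T \<and> (\<forall>r'\<le>r. entry T r' 0 = 0)"

inductive grown :: "tableau \<Rightarrow> bool" where
  empty: "grown empty_tableau"
| row: "grown T \<Longrightarrow> grown (add_row T)"
| column: "grown T \<Longrightarrow> r < height T \<Longrightarrow> unrestricted T r \<Longrightarrow> grown (add_column r T)"
| one: "grown T \<Longrightarrow> one_addable r T \<Longrightarrow> grown (add_one r T)"

lemma add_row_simps [simp]:
  "width (add_row T) = width T" "shape (add_row T) = shape T @ [0]" "entry (add_row T) = entry T"
  "height (add_row T) = Suc (height T)" "unrestricted (add_row T) = unrestricted T"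
  by (auto simp: add_row_def height_def unrestricted_def fun_eq_iff)

lemma add_column_simps [simp]:
  "width (add_column r T) = Suc (width T)" "shape (add_column r T) = map Suc (shape T)"
  "entry (add_column r T) r' 0 = (if r' < height T then of_bool (r' = r) else 2)"
  "entry (add_column r T) r' (Suc j) = entry T r' j"
  "height (add_column r T) = height T"
  by (auto simp: add_column_def height_def)

lemma add_one_simps [simp]:
  "width (add_one r T) = width T" "shape (add_one r T) = shape T"
  "entry (add_one r T) r' j = (if r' = r \<and> j = 0 then 1 else entry T r' j)"
  "height (add_one r T) = height T"
  by (auto simp: add_one_def height_def)

lemma empty_tableau_simps [simp]:
  "width empty_tableau = 0" "shape empty_tableau = []" "entry empty_tableau r j = 2"
  "height empty_tableau = 0"
  by (auto simp: empty_tableau_def height_def)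

lemma closed_simps [simp]:
  "\<not> closed empty_tableau" "\<not> closed (add_row T)" "closed (add_column r T)"
  "closed (add_one r T) = closed T"
  by (auto simp: closed_def)

lemma unrestricted_add_column:
  assumes "r < height T" "u < height T"
  shows "unrestricted (add_column r T) u \<longleftrightarrow> unrestricted T u \<and> u \<le> r"
proof
  assume L: "unrestricted (add_column r T) u"
  have "u \<le> r"
  proof (rule ccontr)
    assume "\<not> u \<le> r"
    then have "entry (add_column r T) u 0 = 0 \<and> r < u \<and> entry (add_column r T) r 0 = 1"
      using assms by simp
    then show False using L unfolding unrestricted_def by blast
  qed
  moreover have "unrestricted T u"
    using L unfolding unrestricted_def by (metis add_column_simps(4))
  ultimately show "unrestricted T u \<and> u \<le> r" by simp
next
  assume R: "unrestricted T u \<and> u \<le> r"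
  have "\<not> (entry (add_column r T) u j = 0 \<and> (\<exists>r'<u. entry (add_column r T) r' j = 1))" for j
    using R assms by (cases j) (auto simp: unrestricted_def)
  then show "unrestricted (add_column r T) u" by (auto simp: unrestricted_def)
qed

text \<open>A row below \<open>r\<close> becomes restricted by a zero under the new one, unless its
  entry in column 0 is not a zero.\<close>

lemma unrestricted_add_one:
  assumes "one_addable r T"
  shows "unrestricted (add_one r T) u \<longleftrightarrow> unrestricted T u \<and> (u \<le> r \<or> entry T u 0 \<noteq> 0)"
proof
  assume L: "unrestricted (add_one r T) u"
  have e0: "entry T r 0 = 0" using assms by (simp add: one_addable_def)
  have "unrestricted T u"
    unfolding unrestricted_def
  proof safe
    fix j r' assume a: "entry T u j = 0" "r' < u" "entry T r' j = 1"
    show False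
    \<comment> \<open>Row \<open>r\<close> could lose a restriction only through the box that ceases
      to be a zero, but this box has no one above it.\<close>
    proof (cases "u = r \<and> j = 0")
      case True
      then show False using a assms by (auto simp: one_addable_def)
    next
      case False
      then have "entry (add_one r T) u j = 0" "entry (add_one r T) r' j = 1" using a by auto
      then show False using L a(2) unfolding unrestricted_def by blast
    qed
  qed
  moreover have "u \<le> r \<or> entry T u 0 \<noteq> 0"
  proof (rule ccontr)
    assume "\<not> ?thesis"
    then have "entry (add_one r T) u 0 = 0" "entry (add_one r T) r 0 = 1" "r < u" by auto
    then show False using L unfolding unrestricted_def by blast
  qed
  ultimately show "unrestricted T u \<and> (u \<le> r \<or> entry T u 0 \<noteq> 0)" by simp
next
  assume "unrestricted T u \<and> (u \<le> r \<or> entry T u 0 \<noteq> 0)"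
  moreover have "entry T u 0 \<noteq> 0" if "r < u" "unrestricted T u \<and> (u \<le> r \<or> entry T u 0 \<noteq> 0)"
    using that by simp
  ultimately show "unrestricted (add_one r T) u"
    unfolding unrestricted_def add_one_simps by (metis not_less zero_neq_one less_asym)
qed

section \<open>Permutation tableaux are exactly the grown tableaux\<close>

lemma permutation_tableauD:
  assumes "permutation_tableau T"
  shows "sorted_wrt (\<ge>) (shape T)" "l \<in> set (shape T) \<Longrightarrow> l \<le> width T"
    "r < height T \<Longrightarrow> j < shape T ! r \<Longrightarrow> entry T r j = 0 \<or> entry T r j = 1"
    "height T \<le> r \<or> shape T ! r \<le> j \<Longrightarrow> entry T r j = 2"
    "j < width T \<Longrightarrow> \<exists>r<height T. entry T r j = 1"
    "entry T r j = 1 \<Longrightarrow> j < j' \<Longrightarrow> entry T r j' = 0 \<Longrightarrow> r' < r \<Longrightarrow> entry T r' j' \<noteq> 1"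
proof -
  note a = assms[unfolded permutation_tableau_def]
  show "sorted_wrt (\<ge>) (shape T)" using a by (elim conjE)
  show "l \<in> set (shape T) \<Longrightarrow> l \<le> width T" using a by (elim conjE) (erule (1) bspec)
  show "j < width T \<Longrightarrow> \<exists>r<height T. entry T r j = 1" using a by (elim conjE) blast
  have "\<forall>(r, j) \<in> boxes T. entry T r j \<in> {0, 1}" using a by (elim conjE)
  then show "r < height T \<Longrightarrow> j < shape T ! r \<Longrightarrow> entry T r j = 0 \<or> entry T r j = 1"
    by (auto simp: boxes_def)
  have "\<forall>r j. (r, j) \<notin> boxes T \<longrightarrow> entry T r j = 2" using a by (elim conjE)
  then show "height T \<le> r \<or> shape T ! r \<le> j \<Longrightarrow> entry T r j = 2"
    by (auto simp: boxes_def)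
  have "\<not> (\<exists>r j. entry T r j = 0 \<and> (\<exists>r' < r. entry T r' j = 1) \<and> (\<exists>j' < j. entry T r j' = 1))"
    using a by (elim conjE)
  then show "entry T r j = 1 \<Longrightarrow> j < j' \<Longrightarrow> entry T r j' = 0 \<Longrightarrow> r' < r \<Longrightarrow> entry T r' j' \<noteq> 1"
    by blast
qed

lemma permutation_tableauI:
  assumes "sorted_wrt (\<ge>) (shape T)" "\<And>l. l \<in> set (shape T) \<Longrightarrow> l \<le> width T"
    "\<And>r j. if r < height T \<and> j < shape T ! r then entry T r j \<in> {0, 1} else entry T r j = 2"
    "\<And>j. j < width T \<Longrightarrow> \<exists>r < height T. entry T r j = 1"
    "\<And>r j j' r'. entry T r j = 1 \<Longrightarrow> j < j' \<Longrightarrow> entry T r j' = 0 \<Longrightarrow> r' < r \<Longrightarrow> entry T r' j' \<noteq> 1"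
  shows "permutation_tableau T"
  unfolding permutation_tableau_def
proof (intro conjI)
  have e: "if r < height T \<and> j < shape T ! r then entry T r j \<in> {0, 1} else entry T r j = 2" for r j
    by (fact assms)
  have "r < height T \<and> j < shape T ! r \<Longrightarrow> entry T r j \<in> {0, 1}" for r j
    using e[of r j] by simp
  then show "\<forall>(r, j) \<in> boxes T. entry T r j \<in> {0, 1}"
    unfolding boxes_def by (simp add: split_beta)
  show "\<forall>r j. (r, j) \<notin> boxes T \<longrightarrow> entry T r j = 2"
    using e by (auto simp: boxes_def split: if_splits)
  show "\<not> (\<exists>r j. entry T r j = 0 \<and> (\<exists>r' < r. entry T r' j = 1) \<and> (\<exists>j' < j. entry T r j' = 1))"
    using assms(5) by blast
qed (use assms(1,2,4) in blast)+

lemma closed_shape_pos: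
  "closed T \<Longrightarrow> r < height T \<Longrightarrow> 0 < shape T ! r"
  unfolding closed_def height_def by (metis gr0I nth_mem)

text \<open>A one at the left end of row \<open>r\<close> has the rest of the row to its right, so
  the forbidden pattern is avoided there exactly if \<open>r\<close> is unrestricted. Zeros in
  column 0 have nothing to their left.\<close>

lemma grown_permutation_tableau: "grown T \<Longrightarrow> permutation_tableau T"
proof (induction rule: grown.induct)
  case empty
  then show ?case by (auto intro!: permutation_tableauI)
next
  case (row T)
  note d = permutation_tableauD[OF row.IH]
  have e: "if r < Suc (height T) \<and> j < (shape T @ [0]) ! r then entry T r j \<in> {0, 1} else entry T r j = 2" for r j
    using d(3)[of r j] d(4)[of r j] by (auto simp: less_Suc_eq nth_append height_def)
  have c: "\<exists>r<Suc (height T). entry T r j = 1" if "j < width T" for j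
    using d(5)[OF that] less_SucI by blast
  show ?case
  proof (rule permutation_tableauI, unfold add_row_simps)
    show "sorted_wrt (\<ge>) (shape T @ [0])" using d(1) by (simp add: sorted_wrt_append)
    show "l \<le> width T" if "l \<in> set (shape T @ [0])" for l using that d(2) by auto
  qed (fact e c d(6))+
next
  case (column T r)
  note d = permutation_tableauD[OF column.IH]
  have e: "if r' < height T \<and> j < map Suc (shape T) ! r' then entry (add_column r T) r' j \<in> {0, 1}
      else entry (add_column r T) r' j = 2" for r' j
    using d(3,4)[of r' "j - 1"] by (cases "r' < height T"; cases j) (auto simp: height_def)
  have c: "\<exists>r'<height T. entry (add_column r T) r' j = 1" if "j < Suc (width T)" for j
    using that d(5) column.hyps(2) by (cases j) auto
  have z: "\<not> (entry (add_column r T) r' j' = 0 \<and> r'' < r' \<and> entry (add_column r T) r'' j' = 1)"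
    if ones: "entry (add_column r T) r' j = 1" "j < j'" for r' j j' r''
  proof (cases j)
    case 0
    then obtain k where "j' = Suc k" using ones by (cases j') auto
    moreover have "r' = r" using ones 0 by (cases "r' = r") (auto split: if_splits)
    moreover have "\<not> (entry T r k = 0 \<and> r'' < r \<and> entry T r'' k = 1)"
      using column.hyps(3) unfolding unrestricted_def by blast
    ultimately show ?thesis by simp
  next
    case (Suc i)
    then obtain k where "j' = Suc k" using ones by (cases j') auto
    then show ?thesis using d(6)[of r' i k r''] ones Suc by auto
  qed
  show ?case
  proof (rule permutation_tableauI, unfold add_column_simps(1,2,5))
    show "sorted_wrt (\<ge>) (map Suc (shape T))" using d(1) by (simp add: sorted_wrt_map)
    show "l \<le> Suc (width T)" if "l \<in> set (map Suc (shape T))" for l using that d(2) by auto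
    show "entry (add_column r T) r'' j' \<noteq> 1"
      if "entry (add_column r T) r' j = 1" "j < j'" "entry (add_column r T) r' j' = 0" "r'' < r'" for r' j j' r''
      using z that by blast
  qed (fact e c)+
next
  case (one T r)
  note d = permutation_tableauD[OF one.IH]
  have o: "r < height T" "unrestricted T r" "closed T" "\<And>r'. r' \<le> r \<Longrightarrow> entry T r' 0 = 0"
    using one.hyps by (auto simp: one_addable_def)
  have e: "if r' < height T \<and> j < shape T ! r' then entry (add_one r T) r' j \<in> {0, 1}
      else entry (add_one r T) r' j = 2" for r' j
    using d(3,4) closed_shape_pos[OF o(3)] o(1) by (auto simp: not_less)
  have c: "\<exists>r'<height T. entry (add_one r T) r' j = 1" if "j < width T" for j
    using d(5)[OF that] by auto
  have z: "\<not> (entry (add_one r T) r' j' = 0 \<and> r'' < r' \<and> entry (add_one r T) r'' j' = 1)"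
    if "entry (add_one r T) r' j = 1" "j < j'" for r' j j' r''
  proof (cases "r' = r")
    case True
    then have "\<not> (entry T r' j' = 0 \<and> r'' < r' \<and> entry T r'' j' = 1)"
      using o(2) unfolding unrestricted_def by blast
    then show ?thesis using True that(2) by simp
  next
    case False
    then show ?thesis using that d(6)[of r' j j' r''] by auto
  qed
  show ?case
  proof (rule permutation_tableauI, unfold add_one_simps(1,2,4))
    show "entry (add_one r T) r'' j' \<noteq> 1"
      if "entry (add_one r T) r' j = 1" "j < j'" "entry (add_one r T) r' j' = 0" "r'' < r'" for r' j j' r''
      using z that by blast
  qed (fact d(1,2) e c)+
qed

text \<open>Every tableau can be taken apart: remove an empty last row; otherwise turn the topmost
  one of column 0 into a zero, or remove the column if this is its only one. The second component of
  the measure serves the case in which the size does not change.\<close>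

lemma permutation_tableau_grown:
  "permutation_tableau T \<Longrightarrow> grown T"
proof (induction T rule: wf_induct_rule[OF wf_measures[of
      "[\<lambda>T. height T + width T, \<lambda>T. card {r. r < height T \<and> entry T r 0 = 1}]"]])
  case (1 T)
  note d = permutation_tableauD[OF 1(2)]
  consider (empty) "shape T = []" | (row) ls where "shape T = ls @ [0]"
    | (pos) "shape T \<noteq> []" "last (shape T) > 0"
    by (metis gr0I rev_exhaust last_snoc)
  then show ?case
  proof cases
    case empty
    \<comment> \<open>Without rows, a column could not contain a one.\<close>
    then have "width T = 0" using d(5)[of 0] by (auto simp: height_def)
    moreover have "entry T = (\<lambda>_ _. 2)" using d(4) empty by (auto simp: fun_eq_iff height_def)
    ultimately have "T = empty_tableau" using empty by (simp add: empty_tableau_def)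
    then show ?thesis by (simp add: grown.empty)
  next
    case (row ls)
    define T' where "T' = T\<lparr>shape := ls\<rparr>"
    have s: "shape T' = ls" "width T' = width T" "entry T' = entry T" "height T' = length ls"
      by (auto simp: T'_def height_def)
    have h: "height T = Suc (length ls)" using row by (simp add: height_def)
    have l2: "entry T (length ls) j = 2" for j using d(4)[of "length ls" j] row by simp
    have n2: "entry T r j = 1 \<Longrightarrow> r < Suc (length ls) \<Longrightarrow> r < length ls" for r j
      using l2[of j] by (auto simp: less_Suc_eq)
    have e: "if r < length ls \<and> j < ls ! r then entry T r j \<in> {0, 1} else entry T r j = 2" for r j
    proof (cases "r < length ls")
      case True
      then show ?thesis using d(3)[of r j] d(4)[of r j] h row by (auto simp: nth_append not_less)
    next
      case False
      then show ?thesis using d(4)[of r j] h l2[of j] by (cases "r = length ls") auto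
    qed
    have "permutation_tableau T'"
    proof (rule permutation_tableauI, unfold s)
      show "sorted_wrt (\<ge>) ls" using d(1) row by (simp add: sorted_wrt_append)
      show "l \<le> width T" if "l \<in> set ls" for l using d(2)[of l] row that by simp
      show "\<exists>r<length ls. entry T r j = 1" if "j < width T" for j
        using d(5)[OF that] n2[of _ j] h by auto
    qed (fact e d(6))+
    then have "grown T'" using 1(1) by (simp add: s h)
    moreover have "T = add_row T'" using row by (simp add: T'_def add_row_def)
    ultimately show ?thesis by (simp add: grown.row)
  next
    case pos
    have shape_pos: "0 < l" if "l \<in> set (shape T)" for l
    proof -
      have "last (shape T) \<le> l"
        using d(1) that pos(1) by (cases "shape T" rule: rev_cases) (auto simp: sorted_wrt_append)
      then show ?thesis using pos(2) by simp
    qed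
    have w: "0 < width T" using pos d(2)[of "last (shape T)"] by fastforce
    have cl: "closed T" using w shape_pos by (auto simp: closed_def)
    note sp = closed_shape_pos[OF cl]
    define r where "r = (LEAST r. entry T r 0 = 1)"
    obtain r0 where "r0 < height T" "entry T r0 0 = 1" using d(5)[OF w] by blast
    then have r: "r < height T" "entry T r 0 = 1"
      using LeastI[of "\<lambda>r. entry T r 0 = 1" r0] Least_le[of "\<lambda>r. entry T r 0 = 1" r0] by (auto simp: r_def)
    have r_least: "entry T r' 0 = 0" if "r' < r" for r'
      using not_less_Least[of r' "\<lambda>r. entry T r 0 = 1"] that d(3)[of r' 0] sp[of r'] r by (auto simp: r_def)
    show ?thesis
    proof (cases "\<exists>r'<height T. r' \<noteq> r \<and> entry T r' 0 = 1")
      case True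
      define T' where "T' = T\<lparr>entry := (\<lambda>r' j. if r' = r \<and> j = 0 then 0 else entry T r' j)\<rparr>"
      have s: "shape T' = shape T" "width T' = width T" "height T' = height T"
        "entry T' r' j = (if r' = r \<and> j = 0 then 0 else entry T r' j)" for r' j
        by (auto simp: T'_def height_def)
      have c: "\<exists>r<height T. entry T' r j = 1" if "j < width T" for j
        using d(5)[OF that] True by (cases "j = 0") (auto simp: s)
      have e: "if r' < height T \<and> j < shape T ! r' then entry T' r' j \<in> {0, 1} else entry T' r' j = 2" for r' j
        using d(3)[of r' j] d(4)[of r' j] sp[OF r(1)] r(1) by (auto simp: s(4))
      have "permutation_tableau T'"
      proof (rule permutation_tableauI, unfold s(1-3))
        fix r' j j' r'' assume "entry T' r' j = 1" "j < j'" "entry T' r' j' = 0" "r'' < r'"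
        then show "entry T' r'' j' \<noteq> 1"
          using d(6)[of r' j j' r''] by (auto simp: s(4) split: if_splits)
      qed (fact d(1,2) e c)+
      moreover have "card {r. r < height T' \<and> entry T' r 0 = 1} < card {r. r < height T \<and> entry T r 0 = 1}"
        using r by (intro psubset_card_mono) (auto simp: s split: if_splits)
      ultimately have "grown T'" using 1(1) by (simp add: s)
      \<comment> \<open>In \<open>T\<close> the one at the left end of row \<open>r\<close> forbids
        zeros under ones in the rest of the row; the box where it stood has no one above it.\<close>
      moreover have "unrestricted T' r"
        using d(6)[OF r(2)] r_least by (auto simp: unrestricted_def s neq0_conv)
      then have "one_addable r T'"
        using cl r r_least by (auto simp: one_addable_def s closed_def order_le_less)
      moreover have "T = add_one r T'"
      proof -
        have "entry T = (\<lambda>r' j. if r' = r \<and> j = 0 then 1 else entry T' r' j)"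
          using r by (auto simp: fun_eq_iff s)
        then show ?thesis by (intro tableau.equality) (simp_all add: add_one_def s)
      qed
      ultimately show ?thesis by (simp add: grown.one)
    next
      case False
      define T' :: tableau where "T' = \<lparr>width = width T - 1, shape = map (\<lambda>l. l - 1) (shape T), entry = (\<lambda>r' j. entry T r' (Suc j))\<rparr>"
      have s: "shape T' = map (\<lambda>l. l - 1) (shape T)" "width T' = width T - 1" "height T' = height T"
        "entry T' r' j = entry T r' (Suc j)" for r' j
        by (auto simp: T'_def height_def)
      have col0: "entry T r' 0 = (if r' < height T then of_bool (r' = r) else 2)" for r'
        using False d(3)[of r' 0] d(4)[of r' 0] sp[of r'] r by auto
      have so: "sorted_wrt (\<ge>) (shape T')"
        using d(1) unfolding s sorted_wrt_map by (rule sorted_wrt_mono_rel[rotated]) auto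
      have e: "if r' < height T \<and> j < shape T' ! r' then entry T' r' j \<in> {0, 1} else entry T' r' j = 2" for r' j
        using d(3)[of r' "Suc j"] d(4)[of r' "Suc j"] by (auto simp: s height_def less_diff_conv)
      have "permutation_tableau T'"
      proof (rule permutation_tableauI)
        fix l assume "l \<in> set (shape T')"
        then show "l \<le> width T'" using d(2) by (auto simp: s diff_le_mono)
      next
        fix r' j j' r'' assume "entry T' r' j = 1" "j < j'" "entry T' r' j' = 0" "r'' < r'"
        then show "entry T' r'' j' \<noteq> 1"
          using d(6)[of r' "Suc j" "Suc j'" r''] by (simp add: s)
      next
        fix j assume "j < width T'"
        then show "\<exists>r<height T'. entry T' r j = 1" using d(5)[of "Suc j"] by (simp add: s)
      next
        show "if r' < height T' \<and> j < shape T' ! r' then entry T' r' j \<in> {0, 1} else entry T' r' j = 2" for r' j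
          unfolding s(3) by (rule e)
      qed (fact so)
      then have "grown T'" using 1(1) w by (simp add: s)
      moreover have "unrestricted T' r"
        using d(6)[OF r(2)] by (auto simp: unrestricted_def s)
      moreover have "T = add_column r T'"
      proof -
        have "entry T = entry (add_column r T')"
        proof (intro ext)
          fix r' j show "entry T r' j = entry (add_column r T') r' j"
            by (cases j) (auto simp: col0 s)
        qed
        moreover have "map (Suc \<circ> (\<lambda>l. l - 1)) (shape T) = shape T"
          using shape_pos by (intro map_idI) auto
        ultimately show ?thesis using w by (intro tableau.equality) (auto simp: s)
      qed
      ultimately show ?thesis using grown.column[of T' r] r(1) s(3) by metis
    qed
  qed
qed

subsection \<open>The change of the map under growth\<close>

text \<open>A column added at the left raises all column indices, whereas labels, counted from the
  northeast, stay the same.\<close>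

fun shift_right :: "path_step \<Rightarrow> path_step" where
  "shift_right (Vert r) = Vert r"
| "shift_right (Horiz j) = Horiz (Suc j)"

lemma shift_right_eq_iff [simp]: "shift_right s = shift_right s' \<longleftrightarrow> s = s'"
  by (cases s; cases s') auto

lemma shift_right_neq [simp]: "shift_right s \<noteq> Horiz 0" "Horiz 0 \<noteq> shift_right s"
  by (cases s; simp)+

section \<open>Steps and labels of the partition path under growth\<close>

lemma partition_path_empty [simp]: "partition_path empty_tableau = []"
  by (simp add: partition_path_def)

lemma partition_path_add_row [simp]:
  "partition_path (add_row T) = partition_path T @ [Vert (height T)]"
proof -
  have "path_from r x (ls @ [0]) = path_from r x ls @ [Vert (r + length ls)]" for r x ls
    by (induction ls arbitrary: r x) auto
  then show ?thesis by (simp add: partition_path_def height_def)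
qed

lemma partition_path_add_column [simp]:
  "partition_path (add_column r T) = map shift_right (partition_path T) @ [Horiz 0]"
proof -
  have Suc_rev: "map Horiz (rev [Suc l..<Suc x]) = map shift_right (map Horiz (rev [l..<x]))" for l x
    unfolding map_Suc_upt[symmetric] rev_map by (simp del: upt_Suc)
  have "path_from r (Suc x) (map Suc ls) = map shift_right (path_from r x ls) @ [Horiz 0]" for r x ls
  proof (induction ls arbitrary: r x)
    case Nil
    have "[0..<Suc x] = 0 # [Suc 0..<Suc x]" by (simp add: upt_rec)
    then show ?case using Suc_rev[of 0 x] by (simp del: upt_Suc)
  next
    case (Cons l ls)
    then show ?case using Suc_rev[of l x] by (simp del: upt_Suc)
  qed
  then show ?thesis by (simp add: partition_path_def)
qed

lemma partition_path_add_one [simp]: "partition_path (add_one r T) = partition_path T"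
  by (simp add: partition_path_def)

lemma partition_path_steps:
  assumes "grown T"
  shows "set (partition_path T) = Vert ` {..<height T} \<union> Horiz ` {..<width T}"
    and "distinct (partition_path T)" and "length (partition_path T) = height T + width T"
proof -
  have "set (partition_path T) = Vert ` {..<height T} \<union> Horiz ` {..<width T}
    \<and> distinct (partition_path T) \<and> length (partition_path T) = height T + width T"
    using assms
  proof (induction rule: grown.induct)
    case (column T r)
    have "shift_right ` Vert ` A = Vert ` A" "shift_right ` Horiz ` A = Horiz ` Suc ` A" for A
      by (simp_all add: image_image)
    moreover have "Horiz ` {..<Suc (width T)} = insert (Horiz 0) (Horiz ` Suc ` {..<width T})"
      unfolding lessThan_Suc_eq_insert_0 by simp
    ultimately show ?case using column.IH
      by (auto simp: distinct_map inj_on_def image_Un)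
  qed (auto simp: lessThan_Suc)
  then show "set (partition_path T) = Vert ` {..<height T} \<union> Horiz ` {..<width T}"
    "distinct (partition_path T)" "length (partition_path T) = height T + width T" by auto
qed

lemma label_add_row:
  assumes "s \<in> set (partition_path T)"
  shows "label (add_row T) s = label T s"
  using assms by (simp add: label_def takeWhile_append1)

lemma label_add_row_last:
  assumes "grown T"
  shows "label (add_row T) (Vert (height T)) = Suc (height T + width T)"
proof -
  have "takeWhile (\<lambda>s'. s' \<noteq> Vert (height T)) (partition_path T) = partition_path T"
    unfolding takeWhile_eq_all_conv partition_path_steps(1)[OF assms] by auto
  then show ?thesis
    by (simp add: label_def takeWhile_append2 partition_path_steps(3)[OF assms] takeWhile_eq_all_conv)
qed

lemma label_add_column:
  assumes "s \<in> set (partition_path T)"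
  shows "label (add_column r T) (shift_right s) = label T s"
proof -
  have "takeWhile (\<lambda>s'. s' \<noteq> shift_right s) (map shift_right (partition_path T) @ [Horiz 0])
     = takeWhile (\<lambda>s'. s' \<noteq> shift_right s) (map shift_right (partition_path T))"
    using assms by (intro takeWhile_append1[of "shift_right s"]) auto
  then show ?thesis by (simp add: label_def takeWhile_map comp_def)
qed

lemma label_add_column_last:
  assumes "grown T"
  shows "label (add_column r T) (Horiz 0) = Suc (height T + width T)"
proof -
  have "takeWhile (\<lambda>s'. s' \<noteq> Horiz 0) (map shift_right (partition_path T) @ [Horiz 0])
     = map shift_right (partition_path T)"
    by (subst takeWhile_append2) auto
  then show ?thesis by (simp add: label_def partition_path_steps(3)[OF assms])
qed

lemma label_add_one [simp]: "label (add_one r T) = label T"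
  by (simp add: label_def fun_eq_iff)

lemma length_takeWhile_neq: "s \<in> set xs \<Longrightarrow> length (takeWhile (\<lambda>s'. s' \<noteq> s) xs) < length xs"
  by (induction xs) auto

lemma step_at_label:
  assumes "s \<in> set (partition_path T)"
  shows "step_at T (label T s) = s"
  using nth_length_takeWhile[of "\<lambda>s'. s' \<noteq> s" "partition_path T"] length_takeWhile_neq[OF assms]
  by (auto simp: step_at_def label_def)

lemma inj_on_label: "inj_on (label T) (set (partition_path T))"
  using step_at_label by (metis inj_onI)

lemma label_image:
  assumes "grown T"
  shows "label T ` set (partition_path T) = {1..height T + width T}"
proof (rule card_subset_eq)
  show "label T ` set (partition_path T) \<subseteq> {1..height T + width T}"
    using length_takeWhile_neq[of _ "partition_path T"] partition_path_steps(3)[OF assms]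
    by (fastforce simp: label_def Suc_le_eq)
  show "card (label T ` set (partition_path T)) = card {1..height T + width T}"
    using partition_path_steps(2,3)[OF assms] by (simp add: card_image inj_on_label distinct_card)
qed simp

text \<open>\<open>Phi\<close> on steps instead of labels. This separates the change of the paths
  under growth from the change of the labels.\<close>

definition endpoint :: "tableau \<Rightarrow> path_step \<Rightarrow> path_step" where
  "endpoint T s = (case s of
     Vert r \<Rightarrow> (case leftmost T r of None \<Rightarrow> s | Some j \<Rightarrow> travel T South r j)
   | Horiz j \<Rightarrow> (case topmost T j of None \<Rightarrow> s | Some r \<Rightarrow> travel T East r j))"

lemma Phi_label:
  assumes "grown T" "s \<in> set (partition_path T)"
  shows "Phi T (label T s) = label T (endpoint T s)"
proof -
  have "label T s \<in> {1..height T + width T}" using label_image[OF assms(1)] assms(2) by blast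
  then show ?thesis
    unfolding Phi_def endpoint_def step_at_label[OF assms(2)]
    by (auto split: path_step.splits option.splits)
qed

lemma Phi_outside: "i \<notin> {1..height T + width T} \<Longrightarrow> Phi T i = i"
  by (auto simp: Phi_def)

lemma Phi_eqI:
  assumes "grown T" "\<And>s. s \<in> set (partition_path T) \<Longrightarrow> label T (endpoint T s) = f (label T s)"
    "\<And>i. i \<notin> {1..height T + width T} \<Longrightarrow> f i = i"
  shows "Phi T = f"
proof
  fix i show "Phi T i = f i"
  proof (cases "i \<in> {1..height T + width T}")
    case True
    then obtain s where "s \<in> set (partition_path T)" "i = label T s"
      using label_image[OF assms(1)] by blast
    then show ?thesis using assms by (simp add: Phi_label)
  qed (simp add: Phi_outside assms(3))
qed

section \<open>Paths of the diagram under growth\<close>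

lemma find_map: "find P (map f xs) = map_option f (find (P \<circ> f) xs)"
  by (induction xs) auto

lemma find_upt_Some:
  "find P [m..<n] = Some k \<longleftrightarrow> m \<le> k \<and> k < n \<and> P k \<and> (\<forall>i. m \<le> i \<and> i < k \<longrightarrow> \<not> P i)"
proof
  assume "find P [m..<n] = Some k"
  then obtain i where "i < n - m" "P (m + i)" "k = m + i" "\<forall>j<i. \<not> P (m + j)"
    by (auto simp: find_Some_iff)
  moreover have "\<not> P i'" if "m \<le> i'" "i' < m + i" for i'
    using calculation(4)[rule_format, of "i' - m"] that by simp
  ultimately show "m \<le> k \<and> k < n \<and> P k \<and> (\<forall>i. m \<le> i \<and> i < k \<longrightarrow> \<not> P i)" by auto
next
  assume "m \<le> k \<and> k < n \<and> P k \<and> (\<forall>i. m \<le> i \<and> i < k \<longrightarrow> \<not> P i)"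
  then show "find P [m..<n] = Some k"
    unfolding find_Some_iff by (intro exI[of _ "k - m"]) auto
qed

lemma topmost_Some_iff:
  "topmost T j = Some r \<longleftrightarrow> r < height T \<and> entry T r j = 1 \<and> (\<forall>r'<r. entry T r' j \<noteq> 1)"
  by (auto simp: topmost_def find_upt_Some)

lemma topmost_exists:
  assumes "grown T" "j < width T"
  shows "\<exists>r. topmost T j = Some r"
proof -
  obtain r where "r < height T" "entry T r j = 1"
    using permutation_tableauD(5)[OF grown_permutation_tableau] assms by blast
  then have "topmost T j \<noteq> None" by (auto simp: topmost_def find_None_iff)
  then show ?thesis by blast
qed

lemma leftmost_Some_iff:
  "leftmost T r = Some j \<longleftrightarrow> j < width T \<and> entry T r j = 1 \<and> (\<forall>j'<j. entry T r j' \<noteq> 1)"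
  by (auto simp: leftmost_def find_upt_Some)

lemma next_south_Some_iff:
  "next_south T r j = Some r' \<longleftrightarrow> r < r' \<and> r' < height T \<and> entry T r' j = 1 \<and> (\<forall>i. r < i \<and> i < r' \<longrightarrow> entry T i j \<noteq> 1)"
  by (auto simp: next_south_def find_upt_Some Suc_le_eq)

declare travel.simps [simp del]

lemma option_eqI: "(\<And>x. a = Some x \<longleftrightarrow> b = Some x) \<Longrightarrow> a = b"
  by (metis option.exhaust option.distinct(1))

lemma travel_in_steps:
  "r < height T \<Longrightarrow> j < width T \<Longrightarrow> travel T d r j \<in> Vert ` {..<height T} \<union> Horiz ` {..<width T}"
proof (induction T d r j rule: travel.induct)
  case (1 T r j)
  then show ?case
    by (subst travel.simps) (auto split: option.splits dest: next_east_bounds)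
next
  case (2 T r j)
  then show ?case
    by (subst travel.simps) (auto split: option.splits dest: next_south_bounds)
qed

lemma endpoint_in_steps:
  assumes "grown T" "s \<in> set (partition_path T)"
  shows "endpoint T s \<in> set (partition_path T)"
proof (cases s)
  case (Vert r)
  then have "r < height T" using assms by (auto simp: partition_path_steps(1))
  then show ?thesis
    using Vert assms(2) travel_in_steps[of r T _ South]
    by (simp add: endpoint_def partition_path_steps(1)[OF assms(1)] leftmost_Some_iff split: option.split)
next
  case (Horiz j)
  then have "j < width T" using assms by (auto simp: partition_path_steps(1))
  then show ?thesis
    using Horiz assms(2) travel_in_steps[of _ T j East]
    by (simp add: endpoint_def partition_path_steps(1)[OF assms(1)] topmost_Some_iff split: option.split)
qed

text \<open>Agreement of single moves passes on to whole paths. \<open>c\<close> renumbers columns,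
  \<open>h\<close> renumbers steps, and \<open>Q\<close> is a region closed under moving east and
  south. A proper region is needed for \<open>add_one\<close>, which changes the move south in a
  part of column 0.\<close>

lemma travel_simulation:
  assumes "\<And>r. h (Vert r) = Vert r" "\<And>j. h (Horiz j) = Horiz (c j)"
    and east: "\<And>r j. Q r j \<Longrightarrow> next_east T' r (c j) = map_option c (next_east T r j)"
    and south: "\<And>r j. Q r j \<Longrightarrow> next_south T' r (c j) = next_south T r j"
    and "\<And>r j j'. Q r j \<Longrightarrow> j < j' \<Longrightarrow> Q r j'" "\<And>r j r'. Q r j \<Longrightarrow> r < r' \<Longrightarrow> Q r' j"
  shows "Q r j \<Longrightarrow> travel T' d r (c j) = h (travel T d r j)"
proof (induction "(height T - r) + (width T - j)" arbitrary: d r j rule: less_induct)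
  case less
  show ?case
  proof (cases d)
    case East
    show ?thesis
    proof (cases "next_east T r j")
      case None
      then show ?thesis using East east[OF less.prems] assms(1) by (simp add: travel.simps)
    next
      case (Some j')
      then have "travel T' South r (c j') = h (travel T South r j')"
        using less assms(5) next_east_bounds[OF Some] by auto
      then show ?thesis using Some East east[OF less.prems] by (simp add: travel.simps(1))
    qed
  next
    case South
    show ?thesis
    proof (cases "next_south T r j")
      case None
      then show ?thesis using South south[OF less.prems] assms(2) by (simp add: travel.simps)
    next
      case (Some r')
      then have "travel T' East r' (c j) = h (travel T East r' j)"
        using less assms(6) next_south_bounds[OF Some] by auto
      then show ?thesis using Some South south[OF less.prems] by (simp add: travel.simps(2))
    qed
  qed
qed

lemma endpoint_add_row:
  assumes "grown T"
  shows "endpoint (add_row T) s = endpoint T s"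
proof -
  have [simp]: "entry T (height T) j = 2" for j
    using permutation_tableauD(4)[OF grown_permutation_tableau[OF assms]] by simp
  have south: "next_south (add_row T) r j = next_south T r j" for r j
    by (rule option_eqI) (auto simp: next_south_Some_iff less_Suc_eq)
  have top: "topmost (add_row T) j = topmost T j" for j
    by (rule option_eqI) (auto simp: topmost_Some_iff less_Suc_eq)
  have "travel (add_row T) d r (id j) = id (travel T d r j)" for d r j
    by (rule travel_simulation[where Q="\<lambda>_ _. True"]) (simp_all add: south next_east_def id_def option.map_ident)
  then show ?thesis
    by (simp add: endpoint_def top leftmost_def cong: path_step.case_cong option.case_cong)
qed

lemma endpoint_add_row_last:
  assumes "grown T"
  shows "endpoint T (Vert (height T)) = Vert (height T)"
proof -
  have "entry T (height T) j = 2" for j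
    using permutation_tableauD(4)[OF grown_permutation_tableau[OF assms]] by simp
  then have "leftmost T (height T) = None"
    by (simp add: leftmost_def find_None_iff)
  then show ?thesis by (simp add: endpoint_def)
qed

text \<open>Old paths move only east and south and so never enter the new column. The path of row
  \<open>r\<close> now drops from the new vertex straight to the new label. The path of the new
  column runs from it to the former leftmost vertex of row \<open>r\<close>, or to the end of the
  row if there was none, and goes on as the path of the row did.\<close>

lemma endpoint_add_column:
  assumes "grown T" "r < height T"
  shows "s \<noteq> Vert r \<Longrightarrow> s \<in> set (partition_path T) \<Longrightarrow> endpoint (add_column r T) (shift_right s) = shift_right (endpoint T s)"
    and "endpoint (add_column r T) (Vert r) = Horiz 0"
    and "endpoint (add_column r T) (Horiz 0) = shift_right (endpoint T (Vert r))"
proof -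
  let ?T = "add_column r T"
  have upt0: "[0..<Suc (width T)] = 0 # map Suc [0..<width T]"
    unfolding map_Suc_upt by (rule upt_conv_Cons) simp
  have east: "next_east ?T r' (Suc j) = map_option Suc (next_east T r' j)" for r' j
    unfolding next_east_def add_column_simps(1) map_Suc_upt[symmetric] by (simp add: comp_def find_map)
  have east0: "next_east ?T r' 0 = map_option Suc (leftmost T r')" for r'
    unfolding next_east_def leftmost_def add_column_simps(1) map_Suc_upt[symmetric] by (simp add: comp_def find_map)
  have south: "next_south ?T r' (Suc j) = next_south T r' j" for r' j
    by (simp add: next_south_def)
  have top: "topmost ?T (Suc j) = topmost T j" for j
    by (simp add: topmost_def)
  have travel: "travel ?T d r' (Suc j) = shift_right (travel T d r' j)" for d r' j
    by (rule travel_simulation[where Q="\<lambda>_ _. True"]) (simp_all add: south east)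
  have left: "leftmost ?T r' = map_option Suc (leftmost T r')" if "r' \<noteq> r" "r' < height T" for r'
    using that unfolding leftmost_def add_column_simps(1) upt0 by (simp add: find_map comp_def)
  have left_r: "leftmost ?T r = Some 0"
    using assms by (simp add: leftmost_Some_iff)
  have top0: "topmost ?T 0 = Some r"
    using assms by (auto simp: topmost_Some_iff)
  have south0: "next_south ?T r 0 = None"
    using assms by (auto simp: next_south_def find_None_iff)
  show "endpoint ?T (Vert r) = Horiz 0"
    by (simp add: endpoint_def left_r travel.simps south0)
  show "endpoint ?T (Horiz 0) = shift_right (endpoint T (Vert r))"
    by (simp add: endpoint_def top0 travel.simps(1) east0 travel split: option.split)
  assume s: "s \<noteq> Vert r" "s \<in> set (partition_path T)"
  show "endpoint ?T (shift_right s) = shift_right (endpoint T s)"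
  proof (cases s)
    case (Vert r')
    then have "r' \<noteq> r" "r' < height T" using s by (auto simp: partition_path_steps(1)[OF assms(1)])
    then show ?thesis using Vert by (simp add: endpoint_def left travel split: option.split)
  next
    case (Horiz j)
    then show ?thesis by (simp add: endpoint_def top travel split: option.split)
  qed
qed

text \<open>From the new vertex, the path of row \<open>r\<close> goes south to the formerly topmost
  vertex of column 0 and leaves it eastwards, as the path of the column did. The path of the column
  goes east to the formerly leftmost vertex of row \<open>r\<close> and continues as the path of the
  row did.\<close>

lemma endpoint_add_one:
  assumes "grown T" "one_addable r T"
  shows "s \<noteq> Vert r \<Longrightarrow> s \<noteq> Horiz 0 \<Longrightarrow> endpoint (add_one r T) s = endpoint T s"
    and "endpoint (add_one r T) (Vert r) = endpoint T (Horiz 0)"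
    and "endpoint (add_one r T) (Horiz 0) = endpoint T (Vert r)"
proof -
  let ?T = "add_one r T"
  have o: "r < height T" "0 < width T" "\<And>r'. r' \<le> r \<Longrightarrow> entry T r' 0 = 0"
    using assms(2) by (auto simp: one_addable_def closed_def)
  have east: "next_east ?T r' j = next_east T r' j" for r' j
    unfolding next_east_def by (intro find_cong) auto
  have south: "next_south ?T r' j = next_south T r' j" if "0 < j \<or> r \<le> r'" for r' j
    unfolding next_south_def using that by (intro find_cong) auto
  \<comment> \<open>The new vertex can be met only by moving south in column 0 from above row
    \<open>r\<close>.\<close>
  have "travel ?T d r' (id j) = id (travel T d r' j)" if "0 < j \<or> r \<le> r'" for d r' j
    by (rule travel_simulation[where Q="\<lambda>r' j. 0 < j \<or> r \<le> r'"]) (use that in \<open>auto simp: south east id_def option.map_ident\<close>)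
  then have travel: "travel ?T d r' j = travel T d r' j" if "0 < j \<or> r \<le> r'" for d r' j
    using that by simp
  have left: "leftmost ?T r' = leftmost T r'" if "r' \<noteq> r" for r'
    unfolding leftmost_def using that by (intro find_cong) auto
  have left_r: "leftmost ?T r = Some 0" "leftmost T r = next_east T r 0"
    unfolding leftmost_def next_east_def add_one_simps(1) upt_conv_Cons[OF o(2)] using o(3)[of r]
    by simp_all
  have top: "topmost ?T j = topmost T j" if "j \<noteq> 0" for j
    unfolding topmost_def using that by (intro find_cong) auto
  have top_r: "topmost ?T 0 = Some r"
    using o(1,3) by (simp add: topmost_Some_iff)
  obtain r2 where r2: "topmost T 0 = Some r2"
    using topmost_exists[OF assms(1) o(2)] by blast
  then have "r < r2" using o(3)[of r2] by (cases "r < r2") (simp_all add: topmost_Some_iff)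
  then have s2: "next_south T r 0 = Some r2"
    using r2 by (auto simp: topmost_Some_iff next_south_Some_iff)
  show "endpoint ?T (Vert r) = endpoint T (Horiz 0)"
    using \<open>r < r2\<close> by (simp add: endpoint_def left_r r2 travel travel.simps(2)[of T r] s2)
  show "endpoint ?T (Horiz 0) = endpoint T (Vert r)"
    by (auto simp: endpoint_def top_r left_r(2) travel travel.simps(1)[of T r] split: option.split)
  assume s: "s \<noteq> Vert r" "s \<noteq> Horiz 0"
  show "endpoint ?T s = endpoint T s"
  proof (cases s)
    case (Vert r')
    \<comment> \<open>A row above \<open>r\<close> has a zero in column 0, so its path starts in a
      later column.\<close>
    have "0 < j \<or> r \<le> r'" if "leftmost T r' = Some j" for j
      using that o(3)[of r'] by (cases "r' \<le> r"; cases j) (auto simp: leftmost_Some_iff)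
    then show ?thesis using Vert s by (auto simp: endpoint_def left travel split: option.split)
  next
    case (Horiz j)
    then show ?thesis using s by (auto simp: endpoint_def top travel split: option.split)
  qed
qed

section \<open>The map \<open>Phi\<close> under the three kinds of growth\<close>

lemma Phi_empty: "Phi empty_tableau = id"
  by (auto simp: Phi_def fun_eq_iff)

lemma Phi_add_row:
  assumes "grown T"
  shows "Phi (add_row T) = Phi T"
proof (rule Phi_eqI)
  show "grown (add_row T)" using assms by (rule grown.row)
  show "Phi T i = i" if "i \<notin> {1..height (add_row T) + width (add_row T)}" for i
    using that by (intro Phi_outside) auto
  fix s assume "s \<in> set (partition_path (add_row T))"
  then consider "s \<in> set (partition_path T)" | "s = Vert (height T)" by auto
  then show "label (add_row T) (endpoint (add_row T) s) = Phi T (label (add_row T) s)"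
  proof cases
    case 1
    then show ?thesis
      using assms by (simp add: endpoint_add_row label_add_row endpoint_in_steps Phi_label)
  next
    case 2
    then show ?thesis
      using assms by (simp add: endpoint_add_row endpoint_add_row_last label_add_row_last Phi_outside)
  qed
qed

lemma label_in_range:
  assumes "grown T" "s \<in> set (partition_path T)"
  shows "label T s \<in> {1..height T + width T}"
  using label_image[OF assms(1)] assms(2) by blast

lemma Vert_in_path: "grown T \<Longrightarrow> r < height T \<Longrightarrow> Vert r \<in> set (partition_path T)"
  by (simp add: partition_path_steps(1))

text \<open>\<open>Phi T\<close> is the identity outside its range, hence fixes the new label, which
  can therefore take part in the exchange.\<close>

lemma Phi_add_column:
  assumes "grown T" "r < height T" "unrestricted T r"
  shows "Phi (add_column r T) = swap_with_last (Suc (height T + width T)) (Phi T) (label T (Vert r))"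
    (is "_ = swap_with_last ?n _ ?l")
proof (rule Phi_eqI)
  let ?T = "add_column r T"
  note V = Vert_in_path[OF assms(1,2)]
  have l: "?l \<in> {1..height T + width T}" by (rule label_in_range[OF assms(1) V])
  show "grown ?T" using assms by (rule grown.column)
  show "swap_with_last ?n (Phi T) ?l i = i" if "i \<notin> {1..height ?T + width ?T}" for i
    using that l by (auto simp: transpose_def intro!: Phi_outside)
  fix s assume "s \<in> set (partition_path ?T)"
  then consider (shift) s' where "s = shift_right s'" "s' \<in> set (partition_path T)" | (last) "s = Horiz 0" by auto
  then show "label ?T (endpoint ?T s) = swap_with_last ?n (Phi T) ?l (label ?T s)"
  proof cases
    case shift
    have le: "label T s' \<in> {1..height T + width T}" by (rule label_in_range[OF assms(1) shift(2)])
    show ?thesis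
    proof (cases "s' = Vert r")
      case True
      then have "label ?T s = ?l" using label_add_column[OF shift(2)] shift(1) by simp
      then show ?thesis
        using True shift endpoint_add_column(2)[OF assms(1,2)] label_add_column_last[OF assms(1)]
          Phi_outside[of ?n T] by simp
    next
      case False
      then have "label T s' \<noteq> ?l" using inj_onD[OF inj_on_label _ shift(2) V] by blast
      then show ?thesis
        using False shift le endpoint_add_column(1)[OF assms(1,2)] label_add_column endpoint_in_steps[OF assms(1)]
          Phi_label[OF assms(1)] by (simp add: transpose_def)
    qed
  next
    case last
    then show ?thesis
      using endpoint_add_column(3)[OF assms(1,2)] label_add_column_last[OF assms(1)] label_add_column
          endpoint_in_steps[OF assms(1) V] Phi_label[OF assms(1) V] by simp
  qed
qed

lemma label_closed:
  assumes "grown T" "closed T"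
  shows "label T (Horiz 0) = height T + width T"
  using assms
proof (induction rule: grown.induct)
  case (column T r)
  then show ?case by (simp add: label_add_column_last)
qed auto

lemma Phi_add_one:
  assumes "grown T" "one_addable r T"
  shows "Phi (add_one r T) = swap_with_last (height T + width T) (Phi T) (label T (Vert r))"
    (is "_ = swap_with_last ?n _ ?l")
proof (rule Phi_eqI)
  let ?T = "add_one r T"
  have r: "r < height T" and c: "closed T" using assms(2) by (auto simp: one_addable_def)
  note V = Vert_in_path[OF assms(1) r]
  have H: "Horiz 0 \<in> set (partition_path T)" 
    using c by (auto simp: partition_path_steps(1)[OF assms(1)] closed_def)
  have l: "?l \<in> {1..height T + width T}" by (rule label_in_range[OF assms(1) V])
  have n: "label T (Horiz 0) = ?n" by (rule label_closed[OF assms(1) c])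
  show "grown ?T" using assms by (rule grown.one)
  show "swap_with_last ?n (Phi T) ?l i = i" if "i \<notin> {1..height ?T + width ?T}" for i
    using that l by (auto simp: transpose_def intro!: Phi_outside)
  fix s assume "s \<in> set (partition_path ?T)"
  then have s: "s \<in> set (partition_path T)" by simp
  consider "s = Vert r" | "s = Horiz 0" | "s \<noteq> Vert r" "s \<noteq> Horiz 0" by blast
  then show "label ?T (endpoint ?T s) = swap_with_last ?n (Phi T) ?l (label ?T s)"
  proof cases
    case 1
    then show ?thesis using endpoint_add_one(2)[OF assms] Phi_label[OF assms(1) H] n by simp
  next
    case 2
    then show ?thesis using endpoint_add_one(3)[OF assms] Phi_label[OF assms(1) V] n by simp
  next
    case 3
    then have "label T s \<noteq> ?l" "label T s \<noteq> ?n"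
      using inj_onD[OF inj_on_label _ s V] inj_onD[OF inj_on_label _ s H] n by auto
    then show ?thesis using 3 endpoint_add_one(1)[OF assms] Phi_label[OF assms(1) s] by (simp add: transpose_def)
  qed
qed

subsection \<open>Invariants of the growth\<close>

abbreviation size_tab :: "tableau \<Rightarrow> nat" where
  "size_tab T \<equiv> height T + width T"

abbreviation row_label :: "tableau \<Rightarrow> nat \<Rightarrow> nat" where
  "row_label T r \<equiv> label T (Vert r)"

lemma row_label_le: "grown T \<Longrightarrow> r < height T \<Longrightarrow> 1 \<le> row_label T r \<and> row_label T r \<le> size_tab T"
  using label_in_range[OF _ Vert_in_path] by auto

lemma row_label_inj: "grown T \<Longrightarrow> r < height T \<Longrightarrow> r' < height T \<Longrightarrow> row_label T r = row_label T r' \<Longrightarrow> r = r'"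
  using inj_onD[OF inj_on_label _ Vert_in_path Vert_in_path] by blast

lemma row_label_add_row: "grown T \<Longrightarrow> r < height T \<Longrightarrow> row_label (add_row T) r = row_label T r"
  by (simp add: label_add_row Vert_in_path)

lemma row_label_add_column: "grown T \<Longrightarrow> r < height T \<Longrightarrow> row_label (add_column r' T) r = row_label T r"
  using label_add_column[OF Vert_in_path, of T r r'] by simp

lemma row_label_less_closed:
  assumes "grown T" "closed T" "r < height T"
  shows "row_label T r < size_tab T"
proof -
  have "Horiz 0 \<in> set (partition_path T)"
    using assms by (auto simp: partition_path_steps(1) closed_def)
  then have "row_label T r \<noteq> label T (Horiz 0)"
    using inj_onD[OF inj_on_label _ Vert_in_path[OF assms(1,3)]] by blast
  then show ?thesis
    using row_label_le[OF assms(1,3)] label_closed[OF assms(1,2)] by simp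
qed

lemma row_label_strict_mono:
  "grown T \<Longrightarrow> r < r' \<Longrightarrow> r' < height T \<Longrightarrow> row_label T r < row_label T r'"
proof (induction arbitrary: r r' rule: grown.induct)
  case (row T)
  show ?case
  proof (cases "r' < height T")
    case True
    then show ?thesis using row by (simp add: row_label_add_row)
  next
    case False
    then have "r' = height T" using row.prems by simp
    then show ?thesis
      using row.hyps row.prems(1) row_label_le[of T r] by (simp add: row_label_add_row label_add_row_last)
  qed
next
  case (column T r0)
  then show ?case by (simp add: row_label_add_column)
qed auto

lemma row_label_le_iff:
  "grown T \<Longrightarrow> r < height T \<Longrightarrow> r' < height T \<Longrightarrow> row_label T r \<le> row_label T r' \<longleftrightarrow> r \<le> r'"
  using row_label_strict_mono by (metis leD le_less_linear nat_less_le order_refl)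

lemma vertical_labels_eq:
  assumes "grown T"
  shows "vertical_labels T = row_label T ` {..<height T}"
proof -
  have "vertical_labels T = {i \<in> label T ` set (partition_path T). \<exists>r. step_at T i = Vert r}"
    unfolding vertical_labels_def label_image[OF assms] ..
  also have "\<dots> = label T ` {s \<in> set (partition_path T). \<exists>r. s = Vert r}"
    using step_at_label by force
  also have "{s \<in> set (partition_path T). \<exists>r. s = Vert r} = Vert ` {..<height T}"
    unfolding partition_path_steps(1)[OF assms] by auto
  finally show ?thesis by (simp add: image_image)
qed

text \<open>By the last clause, the row of the topmost one in column 0 has as its label the first
  position with a value greater than that at the last label. This translates the requirement of
  \<open>one_addable\<close>, to lie above that row, into the inequality of
  \<open>swappable\<close>.\<close>

definition growth_invariant :: "tableau \<Rightarrow> bool" where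
  "growth_invariant T \<longleftrightarrow>
     Phi T permutes {1..size_tab T} \<and>
     weak_excedance_bottoms (size_tab T) (Phi T) = row_label T ` {..<height T} \<and>
     (\<forall>r<height T. unrestricted T r \<longleftrightarrow> lr_max (Phi T) (row_label T r)) \<and>
     (closed T \<longrightarrow> (\<forall>r. topmost T 0 = Some r \<longrightarrow>
        Phi T (size_tab T) < Phi T (row_label T r) \<and>
        (\<forall>j<row_label T r. Phi T j < Phi T (size_tab T))))"

lemma growth_invariantD:
  assumes "growth_invariant T"
  shows "Phi T permutes {1..size_tab T}"
    "weak_excedance_bottoms (size_tab T) (Phi T) = row_label T ` {..<height T}"
    "r < height T \<Longrightarrow> unrestricted T r \<longleftrightarrow> lr_max (Phi T) (row_label T r)"
    "closed T \<Longrightarrow> topmost T 0 = Some r \<Longrightarrow> Phi T (size_tab T) < Phi T (row_label T r)"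
    "closed T \<Longrightarrow> topmost T 0 = Some r \<Longrightarrow> j < row_label T r \<Longrightarrow> Phi T j < Phi T (size_tab T)"
  using assms unfolding growth_invariant_def by blast+

lemma swappable_column:
  assumes "grown T" "growth_invariant T" "r < height T" "unrestricted T r"
  shows "swappable (Suc (size_tab T)) (Phi T) (row_label T r)"
proof -
  note I = growth_invariantD[OF assms(2)]
  have "Phi T permutes {1..Suc (size_tab T)}" by (rule permutes_subset[OF I(1)]) auto
  moreover have "Phi T (row_label T r) \<le> size_tab T"
    using row_label_le[OF assms(1,3)] permutes_atLeastAtMost_bounds(1)[OF I(1)] by simp
  moreover have "Phi T (Suc (size_tab T)) = Suc (size_tab T)" by (rule Phi_outside) simp
  ultimately show ?thesis
    using row_label_le[OF assms(1,3)] I(3)[OF assms(3)] assms(4) by (simp add: swappable_def)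
qed

lemma one_addable_topmost:
  assumes "grown T" "one_addable r T"
  obtains r2 where "topmost T 0 = Some r2" "r < r2" "r2 < height T" "entry T r2 0 = 1"
proof -
  have o: "0 < width T" "\<And>r'. r' \<le> r \<Longrightarrow> entry T r' 0 = 0"
    using assms(2) by (auto simp: one_addable_def closed_def)
  obtain r2 where r2: "topmost T 0 = Some r2" using topmost_exists[OF assms(1) o(1)] by blast
  then have t: "r2 < height T" "entry T r2 0 = 1" by (simp_all add: topmost_Some_iff)
  then have "r < r2" using o(2)[of r2] by (cases "r < r2") simp_all
  with that r2 t show ?thesis by blast
qed

lemma swappable_one:
  assumes "grown T" "growth_invariant T" "one_addable r T"
  shows "swappable (size_tab T) (Phi T) (row_label T r)"
proof -
  note I = growth_invariantD[OF assms(2)]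
  have o: "r < height T" "unrestricted T r" "closed T"
    using assms(3) by (auto simp: one_addable_def)
  obtain r2 where r2: "topmost T 0 = Some r2" "r < r2" "r2 < height T"
    using one_addable_topmost[OF assms(1,3)] by blast
  have "row_label T r < row_label T r2" by (rule row_label_strict_mono[OF assms(1) r2(2,3)])
  then have "Phi T (row_label T r) < Phi T (size_tab T)" using I(5)[OF o(3) r2(1)] by blast
  then show ?thesis
    using row_label_le[OF assms(1) o(1)] I(1) I(3)[OF o(1)] o(2) by (simp add: swappable_def)
qed

lemma growth_invariant: "grown T \<Longrightarrow> growth_invariant T"
proof (induction rule: grown.induct)
  case empty
  then show ?case by (simp add: growth_invariant_def Phi_empty weak_excedance_bottoms_def permutes_def)
next
  case (row T)
  note I = growth_invariantD[OF row.IH]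
  let ?n = "size_tab T"
  have n: "size_tab (add_row T) = Suc ?n" by simp
  have labels: "row_label (add_row T) ` {..<Suc (height T)} = insert (Suc ?n) (row_label T ` {..<height T})"
    unfolding lessThan_Suc image_insert label_add_row_last[OF row.hyps]
    using row.hyps by (intro arg_cong[of _ _ "insert _"] image_cong) (auto simp: row_label_add_row)
  have "unrestricted T r \<longleftrightarrow> lr_max (Phi T) (row_label (add_row T) r)" if "r < Suc (height T)" for r
  proof (cases "r < height T")
    case True
    then show ?thesis using I(3) row.hyps by (simp add: row_label_add_row)
  next
    case False
    then have r: "r = height T" using that by simp
    have "entry T (height T) j = 2" for j
      using permutation_tableauD(4)[OF grown_permutation_tableau[OF row.hyps]] by simp
    then have "unrestricted T r" by (simp add: unrestricted_def r)
    moreover have "Phi T j < Phi T (Suc ?n)" if "j < Suc ?n" for j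
      using that permutes_atLeastAtMost_bounds(1)[OF I(1), of j] by (simp add: Phi_outside)
    then have "lr_max (Phi T) (Suc ?n)" by (simp add: lr_max_def)
    ultimately show ?thesis using row.hyps by (simp add: r label_add_row_last)
  qed
  moreover have "Phi T permutes {1..Suc ?n}" by (rule permutes_subset[OF I(1)]) auto
  ultimately show ?case
    unfolding growth_invariant_def n Phi_add_row[OF row.hyps] weak_excedance_bottoms_Suc[OF I(1)] I(2)
    using labels by simp
next
  case (column T r)
  note I = growth_invariantD[OF column.IH]
  let ?n = "Suc (size_tab T)" and ?T = "add_column r T" and ?l = "row_label T r"
  have n: "size_tab ?T = ?n" by simp
  note sw = swappable_column[OF column.hyps(1) column.IH column.hyps(2,3)]
  note Phi = Phi_add_column[OF column.hyps]
  have labels: "row_label ?T ` {..<height T} = row_label T ` {..<height T}"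
    using column.hyps(1) by (intro image_cong) (auto simp: row_label_add_column)
  have "?n \<notin> row_label T ` {..<height T}"
    using row_label_le[OF column.hyps(1)] by fastforce
  then have "weak_excedance_bottoms ?n (swap_with_last ?n (Phi T) ?l) = row_label T ` {..<height T}"
    unfolding weak_excedance_bottoms_swap[OF sw] weak_excedance_bottoms_Suc[OF I(1)] I(2) by simp
  moreover have "unrestricted ?T u \<longleftrightarrow> lr_max (swap_with_last ?n (Phi T) ?l) (row_label ?T u)" if "u < height T" for u
  proof -
    have le: "row_label T u < ?n" using row_label_le[OF column.hyps(1) that] by simp
    \<comment> \<open>The fixed point \<open>?n\<close> carries the largest value, so the second
      alternative in \<open>swap_with_last_lr_max\<close> does not occur.\<close>
    then have "\<not> Phi T ?n < Phi T (row_label T u)"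
      using permutes_atLeastAtMost_bounds(1)[OF I(1), of "row_label T u"] by (simp add: Phi_outside)
    then show ?thesis
      unfolding row_label_add_column[OF column.hyps(1) that] swap_with_last_lr_max[OF sw le]
        unrestricted_add_column[OF column.hyps(2) that]
      using I(3)[OF that] row_label_le_iff[OF column.hyps(1) that column.hyps(2)] by blast
  qed
  moreover have "r' = r" if "topmost ?T 0 = Some r'" for r'
    using that by (cases "r' = r") (auto simp: topmost_Some_iff)
  moreover have "row_label ?T r = ?l" by (rule row_label_add_column[OF column.hyps(1,2)])
  ultimately show ?case
    unfolding growth_invariant_def n Phi
    using permutes_swap_with_last[OF sw] swap_with_last_least[OF sw] labels
    by (auto simp del: comp_apply)
next
  case (one T r)
  note I = growth_invariantD[OF one.IH]
  let ?n = "size_tab T" and ?T = "add_one r T" and ?l = "row_label T r"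
  have n: "size_tab ?T = ?n" by simp
  have o: "r < height T" "unrestricted T r" "closed T" "\<And>r'. r' \<le> r \<Longrightarrow> entry T r' 0 = 0"
    using one.hyps(2) by (auto simp: one_addable_def)
  note sw = swappable_one[OF one.hyps(1) one.IH one.hyps(2)]
  note Phi = Phi_add_one[OF one.hyps]
  obtain r2 where r2: "topmost T 0 = Some r2" "r < r2" "r2 < height T" "entry T r2 0 = 1"
    using one_addable_topmost[OF one.hyps] by blast
  note least = I(4,5)[OF o(3) r2(1)]
  have "?n \<notin> row_label T ` {..<height T}"
    using row_label_less_closed[OF one.hyps(1) o(3)] by fastforce
  then have "weak_excedance_bottoms ?n (swap_with_last ?n (Phi T) ?l) = row_label T ` {..<height T}"
    unfolding weak_excedance_bottoms_swap[OF sw] I(2) by simp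
  moreover have "unrestricted ?T u \<longleftrightarrow> lr_max (swap_with_last ?n (Phi T) ?l) (row_label ?T u)" if u: "u < height T" for u
  proof -
    have le: "row_label T u < ?n" by (rule row_label_less_closed[OF one.hyps(1) o(3) u])
    \<comment> \<open>For unrestricted rows, column 0 has zeros above the topmost one and no zeros
      below it. Their values increase from row to row and first exceed the value at
      \<open>?n\<close> in the row \<open>r2\<close> of that one.\<close>
    have "entry T u 0 \<noteq> 0 \<longleftrightarrow> Phi T ?n < Phi T (row_label T u)" if U: "unrestricted T u"
    proof -
      consider "u < r2" | "u = r2" | "r2 < u" by linarith
      then show ?thesis
      proof cases
        case 1
        have "entry T u 0 = 0"
          using 1 r2(1) permutation_tableauD(3)[OF grown_permutation_tableau[OF one.hyps(1)] u
              closed_shape_pos[OF o(3) u]] by (auto simp: topmost_Some_iff)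
        moreover have "Phi T (row_label T u) < Phi T ?n"
          by (rule least(2)) (rule row_label_strict_mono[OF one.hyps(1) 1 r2(3)])
        ultimately show ?thesis by simp
      next
        case 2
        then show ?thesis using least(1) r2(4) by simp
      next
        case 3
        have "entry T u 0 \<noteq> 0" using U 3 r2(4) by (auto simp: unrestricted_def)
        moreover have "Phi T (row_label T r2) < Phi T (row_label T u)"
          using I(3)[OF u] U row_label_strict_mono[OF one.hyps(1) 3 u] by (simp add: lr_max_def)
        ultimately show ?thesis using least(1) by simp
      qed
    qed
    then show ?thesis
      unfolding label_add_one swap_with_last_lr_max[OF sw le] unrestricted_add_one[OF one.hyps(2)]
      using I(3)[OF u] row_label_le_iff[OF one.hyps(1) u o(1)] by blast
  qed
  moreover have "r' = r" if "topmost ?T 0 = Some r'" for r'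
  proof -
    have "topmost ?T 0 = Some r" using o(1,4) by (simp add: topmost_Some_iff)
    then show ?thesis using that by simp
  qed
  ultimately show ?case
    unfolding growth_invariant_def n Phi
    using permutes_swap_with_last[OF sw] swap_with_last_least[OF sw]
    by (auto simp del: comp_apply)
qed

lemma wex_Phi:
  assumes "grown T"
  shows "wex (size_tab T) (Phi T) = height T"
proof -
  have "inj_on (row_label T) {..<height T}"
    using row_label_inj[OF assms] by (auto intro: inj_onI)
  then show ?thesis
    unfolding wex_def growth_invariantD(2)[OF growth_invariant[OF assms]] by (simp add: card_image)
qed

text \<open>The last label is a weak excedance bottom exactly if it belongs to a vertical step. Thus
  the permutation reveals whether the last growth step added a row.\<close>

lemma Phi_last_less_iff_closed:
  assumes "grown T" "0 < size_tab T"
  shows "Phi T (size_tab T) < size_tab T \<longleftrightarrow> closed T"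
proof -
  note I = growth_invariantD[OF growth_invariant[OF assms(1)]]
  show ?thesis
  proof
    assume "closed T"
    then have "size_tab T \<notin> weak_excedance_bottoms (size_tab T) (Phi T)"
      unfolding I(2) using row_label_less_closed[OF assms(1)] by fastforce
    then show "Phi T (size_tab T) < size_tab T"
      using assms(2) by (auto simp: weak_excedance_bottoms_def)
  next
    assume *: "Phi T (size_tab T) < size_tab T"
    show "closed T" using assms(1)
    proof cases
      case (row T')
      then show ?thesis using * Phi_add_row[of T'] Phi_outside[of "Suc (size_tab T')" T'] by simp
    qed (use assms(2) in \<open>auto simp: one_addable_def\<close>)
  qed
qed

lemma not_closed_cases:
  assumes "grown T" "0 < size_tab T" "\<not> closed T"
  obtains T' where "grown T'" "T = add_row T'"
  using assms by (cases rule: grown.cases) (auto simp: one_addable_def)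

subsection \<open>Entries and statistics\<close>

lemma num_entries_sum:
  "num_entries T v = (\<Sum>r<height T. \<Sum>j<width T. of_bool (entry T r j = v))"
proof -
  have "{(r, j). r < height T \<and> j < width T \<and> entry T r j = v}
     = Sigma {..<height T} (\<lambda>r. {j \<in> {..<width T}. entry T r j = v})" by auto
  then show ?thesis unfolding num_entries_def by (simp add: Int_def)
qed

lemma num_entries_empty: "num_entries empty_tableau v = 0"
  by (simp add: num_entries_sum)

lemma num_entries_add_row:
  assumes "grown T"
  shows "num_entries (add_row T) v = num_entries T v + width T * of_bool (v = 2)"
proof -
  have "entry T (height T) j = 2" for j
    using permutation_tableauD(4)[OF grown_permutation_tableau[OF assms]] by simp
  then show ?thesis unfolding num_entries_sum by (auto simp: of_bool_def)
qed

lemma num_entries_add_column: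
  assumes "r < height T"
  shows "num_entries (add_column r T) 0 = num_entries T 0 + (height T - 1)"
    and "num_entries (add_column r T) 1 = num_entries T 1 + 1"
    and "num_entries (add_column r T) 2 = num_entries T 2"
proof -
  have *: "num_entries (add_column r T) v =
      num_entries T v + (\<Sum>r'<height T. of_bool ((of_bool (r' = r) :: nat) = v))" for v
    unfolding num_entries_sum
    by (simp add: sum.lessThan_Suc_shift sum.distrib del: sum.lessThan_Suc sum_of_bool_eq cong: sum.cong_simp)
  have "(\<Sum>r'<height T. of_bool ((of_bool (r' = r) :: nat) = 0)) = (\<Sum>r'\<in>{..<height T} - {r}. (1::nat))"
    by (intro sum.mono_neutral_cong_right) auto
  moreover have "(\<Sum>r'<height T. of_bool ((of_bool (r' = r) :: nat) = 1)) = (\<Sum>r'\<in>{r}. (1::nat))"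
    using assms by (intro sum.mono_neutral_cong_right) auto
  moreover have "(\<Sum>r'<height T. of_bool ((of_bool (r' = r) :: nat) = 2)) = (0::nat)"
    by (intro sum.neutral) auto
  ultimately show "num_entries (add_column r T) 0 = num_entries T 0 + (height T - 1)"
    "num_entries (add_column r T) 1 = num_entries T 1 + 1"
    "num_entries (add_column r T) 2 = num_entries T 2"
    using assms unfolding * by simp_all
qed

lemma num_entries_add_one:
  assumes "one_addable r T"
  shows "num_entries T 0 = num_entries (add_one r T) 0 + 1"
    and "num_entries (add_one r T) 1 = num_entries T 1 + 1"
    and "num_entries (add_one r T) 2 = num_entries T 2"
proof -
  define E where "E T v = {(r, j). r < height T \<and> j < width T \<and> entry T r j = v}" for T v
  have o: "r < height T" "0 < width T" "entry T r 0 = 0"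
    using assms by (auto simp: one_addable_def closed_def)
  have fin: "finite (E T v)" for T v
    by (rule finite_subset[of _ "{..<height T} \<times> {..<width T}"]) (auto simp: E_def)
  have num: "num_entries T v = card (E T v)" for T v
    by (simp add: num_entries_def E_def)
  have "E T 0 = insert (r, 0) (E (add_one r T) 0)" "(r, 0) \<notin> E (add_one r T) 0"
    using o by (auto simp: E_def)
  then show "num_entries T 0 = num_entries (add_one r T) 0 + 1"
    using fin by (simp add: num)
  have "E (add_one r T) 1 = insert (r, 0) (E T 1)" "(r, 0) \<notin> E T 1"
    using o by (auto simp: E_def)
  then show "num_entries (add_one r T) 1 = num_entries T 1 + 1"
    using fin by (simp add: num)
  have "E (add_one r T) 2 = E T 2" using o by (auto simp: E_def intro!: gr0I)
  then show "num_entries (add_one r T) 2 = num_entries T 2"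
    by (simp add: num)
qed

text \<open>\<open>width T\<close> is a separate summand because the first one of each column leaves
  the sum of \<open>C_pair\<close> unchanged.\<close>

lemma num_entries_pair_sum:
  "grown T \<Longrightarrow>
    int (num_entries T 0) = pair_sum A_pair (size_tab T) (Phi T) \<and>
    int (num_entries T 1) = pair_sum C_pair (size_tab T) (Phi T) + int (width T) \<and>
    int (num_entries T 2) = pair_sum NE_pair (size_tab T) (Phi T)"
proof (induction rule: grown.induct)
  case empty
  show ?case by (simp add: num_entries_empty pair_sum_def)
next
  case (row T)
  note p = growth_invariantD(1)[OF growth_invariant[OF row.hyps]]
  show ?case
    using row.IH wex_Phi[OF row.hyps] num_entries_add_row[OF row.hyps]
      pair_sum_Suc_A[OF p] pair_sum_Suc_C[OF p] pair_sum_Suc_NE[OF p]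
    by (simp add: Phi_add_row[OF row.hyps])
next
  case (column T r)
  note inv = growth_invariant[OF column.hyps(1)]
  note p = growth_invariantD(1)[OF inv]
  note sw = swappable_column[OF column.hyps(1) inv column.hyps(2,3)]
  have last: "Phi T (Suc (size_tab T)) = Suc (size_tab T)" by (rule Phi_outside) simp
  \<comment> \<open>Before the exchange the new label is a fixed point and counts in
    \<open>wex\<close>, so the change \<open>wex - 2\<close> from \<open>pair_sum_swap_A\<close>
    equals \<open>height T - 1\<close>.\<close>
  have "wex (Suc (size_tab T)) (Phi T) = Suc (height T)"
    using wex_Phi[OF column.hyps(1)]
    unfolding wex_def weak_excedance_bottoms_Suc[OF p]
    by (subst card_insert_disjoint) (auto simp: weak_excedance_bottoms_def)
  moreover have "int (num_entries (add_column r T) 0) = int (num_entries T 0) + int (height T) - 1"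
    using num_entries_add_column(1)[OF column.hyps(2)] column.hyps(2) by linarith
  ultimately show ?case
    using column.IH wex_Phi[OF column.hyps(1)] num_entries_add_column(2,3)[OF column.hyps(2)]
      pair_sum_Suc_A[OF p] pair_sum_Suc_C[OF p] pair_sum_Suc_NE[OF p]
      pair_sum_swap_A[OF sw] pair_sum_swap_C[OF sw] pair_sum_swap_NE[OF sw] last
    by (simp add: Phi_add_column[OF column.hyps] del: comp_apply)
next
  case (one T r)
  note inv = growth_invariant[OF one.hyps(1)]
  note sw = swappable_one[OF one.hyps(1) inv one.hyps(2)]
  have "Phi T (size_tab T) < size_tab T"
    using Phi_last_less_iff_closed[OF one.hyps(1)] one.hyps(2) by (auto simp: one_addable_def)
  then show ?case
    using one.IH num_entries_add_one[OF one.hyps(2)]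
      pair_sum_swap_A[OF sw] pair_sum_swap_C[OF sw] pair_sum_swap_NE[OF sw]
    by (simp add: Phi_add_one[OF one.hyps] del: comp_apply)
qed

subsection \<open>Bijectivity\<close>

text \<open>The permutation determines the last growth step. \<open>Phi_last_less_iff_closed\<close>
  recognizes an added row; otherwise \<open>swap_with_last_cancel\<close> yields the permutation
  before the exchange, which fixes the last label after \<open>add_column\<close> but not after
  \<open>add_one\<close>.\<close>

lemma Phi_injective:
  assumes "grown T" "grown T'" "size_tab T = size_tab T'" "Phi T = Phi T'"
  shows "T = T'"
  using assms
proof (induction arbitrary: T' rule: grown.induct)
  case empty
  from empty(1) show ?case by cases (use empty(2) in \<open>auto simp: one_addable_def\<close>)
next
  case (row T)
  have "0 < size_tab T'" using row.prems(2) unfolding add_row_simps by linarith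
  then have "\<not> closed T'"
    using Phi_last_less_iff_closed[OF row.prems(1)] Phi_last_less_iff_closed[OF grown.row[OF row.hyps]]
      row.prems by simp
  then obtain T2 where T2: "grown T2" "T' = add_row T2"
    using not_closed_cases[OF row.prems(1) \<open>0 < size_tab T'\<close>] by blast
  then have "T = T2"
    using row.IH[OF T2(1)] row.prems row.hyps by (simp add: Phi_add_row)
  then show ?case using T2 by simp
next
  case (column T r)
  note sw = swappable_column[OF column.hyps(1) growth_invariant[OF column.hyps(1)] column.hyps(2,3)]
  have "0 < size_tab T'" using column.prems(2) unfolding add_column_simps by linarith
  then have "closed T'"
    using Phi_last_less_iff_closed[OF column.prems(1)] Phi_last_less_iff_closed[OF grown.column[OF column.hyps]]
      column.prems by simp
  from column.prems(1) show ?case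
  proof cases
    case (column T2 r2)
    note sw2 = swappable_column[OF column(2) growth_invariant[OF column(2)] column(3,4)]
    have n: "size_tab T = size_tab T2" using column.prems(2) column(1) by simp
    have "swap_with_last (Suc (size_tab T)) (Phi T) (row_label T r)
      = swap_with_last (Suc (size_tab T)) (Phi T2) (row_label T2 r2)"
      using column.prems(3) Phi_add_column[OF column.hyps] Phi_add_column[OF column(2-4)] column(1) n by metis
    then have "row_label T r = row_label T2 r2 \<and> Phi T = Phi T2"
      by (rule swap_with_last_cancel) (use sw sw2 n in simp_all)
    moreover then have "T = T2" using column.IH column(2) n by blast
    ultimately show ?thesis using row_label_inj column(1-3) column.hyps(2) by auto
  next
    case (one T2 r2)
    note sw2 = swappable_one[OF one(2) growth_invariant[OF one(2)] one(3)]
    have n: "Suc (size_tab T) = size_tab T2" using column.prems(2) one(1) by simp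
    have "swap_with_last (size_tab T2) (Phi T) (row_label T r)
      = swap_with_last (size_tab T2) (Phi T2) (row_label T2 r2)"
      using column.prems(3) Phi_add_column[OF column.hyps] Phi_add_one[OF one(2,3)] one(1) n by metis
    then have "Phi T = Phi T2"
      using swap_with_last_cancel sw sw2 n by metis
    moreover have "Phi T (size_tab T2) = size_tab T2"
      using n by (intro Phi_outside) auto
    moreover have "Phi T2 (size_tab T2) < size_tab T2"
      using Phi_last_less_iff_closed[OF one(2)] one(3) by (auto simp: one_addable_def)
    ultimately show ?thesis by simp
  qed (use \<open>closed T'\<close> in auto)
next
  case (one T r)
  note sw = swappable_one[OF one.hyps(1) growth_invariant[OF one.hyps(1)] one.hyps(2)]
  have lt: "Phi T (size_tab T) < size_tab T"
      using Phi_last_less_iff_closed[OF one.hyps(1)] one.hyps(2) by (auto simp: one_addable_def)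
  have "0 < size_tab T'" using one.prems(2) lt unfolding add_one_simps by linarith
  then have "closed T'"
    using Phi_last_less_iff_closed[OF one.prems(1)] Phi_last_less_iff_closed[OF grown.one[OF one.hyps]]
      one.prems one.hyps by (simp add: one_addable_def)
  from one.prems(1) show ?case
  proof cases
    case (column T2 r2)
    note sw2 = swappable_column[OF column(2) growth_invariant[OF column(2)] column(3,4)]
    have n: "size_tab T = Suc (size_tab T2)" using one.prems(2) column(1) by simp
    have "swap_with_last (size_tab T) (Phi T) (row_label T r)
      = swap_with_last (size_tab T) (Phi T2) (row_label T2 r2)"
      using one.prems(3) Phi_add_one[OF one.hyps] Phi_add_column[OF column(2-4)] column(1) n by metis
    then have "Phi T = Phi T2"
      using swap_with_last_cancel sw sw2 n by metis
    moreover have "Phi T2 (size_tab T) = size_tab T"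
      using n by (intro Phi_outside) auto
    ultimately show ?thesis using lt by simp
  next
    case (one T2 r2)
    note sw2 = swappable_one[OF one(2) growth_invariant[OF one(2)] one(3)]
    have n: "size_tab T = size_tab T2" using one.prems(2) one(1) by simp
    have "swap_with_last (size_tab T) (Phi T) (row_label T r)
      = swap_with_last (size_tab T) (Phi T2) (row_label T2 r2)"
      using one.prems(3) Phi_add_one[OF one.hyps] Phi_add_one[OF one(2,3)] one(1) n by metis
    then have *: "row_label T r = row_label T2 r2 \<and> Phi T = Phi T2"
      by (rule swap_with_last_cancel) (use sw sw2 n in simp_all)
    then have T2: "T = T2" using one.IH[OF one(2) n] by blast
    then have "r = r2"
      using * row_label_inj[OF one.hyps(1)] one.hyps(2) one(3) by (auto simp: one_addable_def)
    then show ?thesis using T2 one(1) by simp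
  qed (use \<open>closed T'\<close> in auto)
qed

lemma Phi_surjective:
  assumes "\<sigma> permutes {1..n}"
  shows "\<exists>T. grown T \<and> size_tab T = n \<and> Phi T = \<sigma>"
  using assms
proof (induction "(n, \<sigma>)" arbitrary: n \<sigma> rule: wf_induct_rule[OF wf_measures[of
      "[\<lambda>(n, \<sigma>). n, \<lambda>(n, \<sigma>). n - \<sigma> n]"]])
  case 1
  consider "n = 0" | m where "n = Suc m" "\<sigma> n = n" | "\<sigma> n < n"
    using permutes_atLeastAtMost_bounds(1)[OF 1(2), of n] by (cases n) (auto simp: le_less)
  then show ?case
  proof cases
    case 1
    then show ?thesis
      using \<open>\<sigma> permutes {1..n}\<close> by (intro exI[of _ empty_tableau]) (auto simp: grown.empty Phi_empty)
  next
    case (2 m)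
    have "\<sigma> permutes {1..m}"
      using 1(2) by (rule permutes_superset) (use 2 in \<open>auto simp: le_Suc_eq\<close>)
    then obtain T where "grown T" "size_tab T = m" "Phi T = \<sigma>"
      using 1(1)[of m \<sigma>] 2(1) by auto
    then show ?thesis
      using 2(1) by (intro exI[of _ "add_row T"]) (auto simp: grown.row Phi_add_row)
  next
    case 3
    obtain \<rho> l where sw: "swappable n \<rho> l" and \<sigma>: "\<sigma> = swap_with_last n \<rho> l" and lt: "\<sigma> n < \<rho> n"
      using swap_with_last_exists[OF 1(2) 3] .
    note f = swappable_facts[OF sw]
    obtain T where T: "grown T" "size_tab T = n" "Phi T = \<rho>"
      using 1(1)[of n \<rho>] diff_less_mono2[OF lt 3] f(1) by auto
    note I = growth_invariantD[OF growth_invariant[OF T(1)], unfolded T(2,3)]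
    have "l \<in> weak_excedance_bottoms n \<rho>"
      using f(3-5) by (simp add: weak_excedance_bottoms_def)
    then obtain r where r: "r < height T" "l = row_label T r" unfolding I(2) by auto
    then have U: "unrestricted T r" using I(3) f(8) by simp
    show ?thesis
    proof (cases "\<rho> n = n")
      case True
      \<comment> \<open>The tableau of \<open>\<rho>\<close> ends in an empty row for the fixed
        point \<open>n\<close>; the tableau of \<open>\<sigma>\<close> has a new column in place of
        this row.\<close>
      then obtain T' where T': "grown T'" "T = add_row T'"
        using not_closed_cases[OF T(1)] Phi_last_less_iff_closed[OF T(1)] T(2,3) f(4) by auto
      have n: "n = Suc (size_tab T')" using T(2) T'(2) by simp
      have "r \<noteq> height T'"
        using r(2) f(4) n T' by (auto simp: label_add_row_last)
      then have r': "r < height T'" using r(1) T'(2) by simp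
      have U': "unrestricted T' r" using U T'(2) by simp
      have "Phi (add_column r T') = \<sigma>"
        unfolding Phi_add_column[OF T'(1) r' U'] \<sigma> n
        using T(3) T'(2) Phi_add_row[OF T'(1)] r(2) row_label_add_row[OF T'(1) r'] by simp
      then show ?thesis
        using grown.column[OF T'(1) r' U'] n by (intro exI[of _ "add_column r T'"]) simp
    next
      case False
      then have c: "closed T"
        using Phi_last_less_iff_closed[OF T(1)] T(2,3) f(4,7) by auto
      then obtain r2 where r2: "topmost T 0 = Some r2"
        using topmost_exists[OF T(1)] by (auto simp: closed_def)
      then have h2: "r2 < height T" by (simp add: topmost_Some_iff)
      \<comment> \<open>The value at the label of row \<open>r2\<close> exceeds
        \<open>\<rho> n\<close>, hence \<open>\<rho> l\<close>, whereas up to the maximum at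
        \<open>l\<close> no value exceeds \<open>\<rho> l\<close>.\<close>
      have "r < r2"
      proof (rule ccontr)
        assume "\<not> r < r2"
        then have "row_label T r2 \<le> l" using row_label_le_iff[OF T(1) h2 r(1)] r(2) by simp
        then have "\<rho> (row_label T r2) \<le> \<rho> l" using f(8) by (auto simp: lr_max_def le_less)
        then show False using I(4)[OF c r2] f(6) by simp
      qed
      have "entry T r' 0 = 0" if "r' \<le> r" for r'
      proof -
        have "r' < height T" "r' < r2" using that r(1) \<open>r < r2\<close> by simp_all
        then show ?thesis
          using r2 permutation_tableauD(3)[OF grown_permutation_tableau[OF T(1)] _
              closed_shape_pos[OF c], of r'] by (auto simp: topmost_Some_iff)
      qed
      then have o: "one_addable r T" using r(1) U c by (simp add: one_addable_def)
      have "Phi (add_one r T) = \<sigma>"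
        unfolding Phi_add_one[OF T(1) o] \<sigma> using T r by simp
      then show ?thesis
        using grown.one[OF T(1) o] T(2) by (intro exI[of _ "add_one r T"]) simp
    qed
  qed
qed

text \<open>The equivalence restricts one bijection to every class at once: one direction maps a
  class into its counterpart, the other places the preimages from \<open>Phi_surjective\<close> in
  the right class.\<close>

lemma tableaux_iff_perms:
  assumes "grown T" "size_tab T = n"
  shows "T \<in> tableaux n k a b c \<longleftrightarrow> Phi T \<in> perms n k a b c"
proof -
  note s = num_entries_pair_sum[OF assms(1), unfolded assms(2) statistics_pair_sum[symmetric]]
  have "num_entries T 0 = A_EE n (Phi T) + A_NN n (Phi T) + A_EN n (Phi T)"
    "num_entries T 1 = C_EE n (Phi T) + C_NN n (Phi T) + width T"
    "num_entries T 2 = A_NE n (Phi T)"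
    using s by linarith+
  moreover have "width T = n - height T" "height T \<le> n" using assms(2) by simp_all
  moreover have "Phi T permutes {1..n}" "wex n (Phi T) = height T"
    using growth_invariantD(1)[OF growth_invariant[OF assms(1)]] wex_Phi[OF assms(1)] assms(2) by simp_all
  ultimately show ?thesis
    using grown_permutation_tableau[OF assms(1)] unfolding tableaux_def perms_def by auto
qed

lemma tableaux_grown:
  "T \<in> tableaux n k a b c \<Longrightarrow> grown T \<and> size_tab T = n"
  by (auto simp: tableaux_def permutation_tableau_grown)

theorem theorem14:
  fixes n k a b c :: nat
  assumes "n \<ge> 1"
  shows "card (tableaux n k a b c) = card (perms n k a b c) \<and>
         bij_betw Phi (tableaux n k a b c) (perms n k a b c) \<and>
         (\<forall>T \<in> tableaux n k a b c. weak_excedance_bottoms n (Phi T) = vertical_labels T)"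
proof -
  have "inj_on Phi (tableaux n k a b c)"
  proof (rule inj_onI)
    fix T T' assume "T \<in> tableaux n k a b c" "T' \<in> tableaux n k a b c" "Phi T = Phi T'"
    then show "T = T'" using tableaux_grown by (intro Phi_injective) auto
  qed
  moreover have "Phi ` tableaux n k a b c = perms n k a b c"
  proof (intro equalityI subsetI)
    fix \<pi> assume "\<pi> \<in> Phi ` tableaux n k a b c"
    then show "\<pi> \<in> perms n k a b c" using tableaux_grown tableaux_iff_perms by blast
  next
    fix \<pi> assume \<pi>: "\<pi> \<in> perms n k a b c"
    then have "\<pi> permutes {1..n}" by (simp add: perms_def)
    then show "\<pi> \<in> Phi ` tableaux n k a b c"
      using Phi_surjective tableaux_iff_perms \<pi> by blast
  qed
  ultimately have "bij_betw Phi (tableaux n k a b c) (perms n k a b c)"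
    by (simp add: bij_betw_def)
  moreover have "weak_excedance_bottoms n (Phi T) = vertical_labels T" if "T \<in> tableaux n k a b c" for T
    using tableaux_grown[OF that] growth_invariantD(2)[OF growth_invariant] vertical_labels_eq by auto
  ultimately show ?thesis using bij_betw_same_card by blast
qed

end
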